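(* Let $(T_1,T_2)$ be a pair of contractions on a Hilbert space $\mathcal{H}$ such that $T_1T_2=qT_2T_1$, where $q$ is a unimodular complex number. Then there exist a Hilbert space $\mathcal{K}$ containing $\mathcal{H}$ and a pair of isometries $(V_1,V_2)$ on $\mathcal{K}$ such that $V_1V_2=qV_2V_1$ and $$T_1^{k_1}T_2^{k_2}=P_{\mathcal{H}}V_1^{k_1}V_2^{k_2}|_{\mathcal{H}}\qquad\text{for all } k_1,k_2\in\mathbb{Z}_+ .$$
   Context: All Hilbert spaces are complex; a contraction is a bounded operator of norm at most $1$; $\mathbb{Z}_+$ is the set of non-negative integers; $P_{\mathcal{H}}$ is the orthogonal projection of $\mathcal{K}$ onto $\mathcal{H}$. *)

theory Defs
  imports "HOL-Analysis.Analysis" "HOL-Algebra.Algebraic_Closure_Type"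
begin

text \<open>
  Spaces are records with an explicit carrier, so that the existence of a Hilbert space can be
  stated inside a formula.  The vector space structure is that of a module over the field of
  complex numbers; the ring multiplication and unit that the module record also carries are unused.
\<close>

record 'a inner_space = "(complex, 'a) module" +
  cinner :: "'a \<Rightarrow> 'a \<Rightarrow> complex"

abbreviation complex_ring :: "complex ring"
  where "complex_ring \<equiv> ring_of_type_algebra"

locale complex_inner_space = module complex_ring H for H :: "'a inner_space" (structure) +
  assumes cinner_add_left:
      "\<lbrakk>x \<in> carrier H; y \<in> carrier H; z \<in> carrier H\<rbrakk>
        \<Longrightarrow> cinner H (x \<oplus> y) z = cinner H x z + cinner H y z"
    and cinner_smult_left:
      "\<lbrakk>x \<in> carrier H; y \<in> carrier H\<rbrakk> \<Longrightarrow> cinner H (a \<odot> x) y = a * cinner H x y"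
    and cinner_cnj:
      "\<lbrakk>x \<in> carrier H; y \<in> carrier H\<rbrakk> \<Longrightarrow> cinner H y x = cnj (cinner H x y)"
    and cinner_nonneg: "x \<in> carrier H \<Longrightarrow> 0 \<le> Re (cinner H x x)"
    and cinner_definite: "\<lbrakk>x \<in> carrier H; cinner H x x = 0\<rbrakk> \<Longrightarrow> x = \<zero>"

definition hnorm :: "'a inner_space \<Rightarrow> 'a \<Rightarrow> real"
  where "hnorm H x = sqrt (Re (cinner H x x))"

text \<open>
  The locale \<^locale>\<open>Metric_space\<close> asks for symmetry and non-negativity also outside the carrier,
  hence the value 0 there.
\<close>

definition hdist :: "'a inner_space \<Rightarrow> 'a \<Rightarrow> 'a \<Rightarrow> real"
  where "hdist H x y =
    (if x \<in> carrier H \<and> y \<in> carrier H then hnorm H (x \<ominus>\<^bsub>H\<^esub> y) else 0)"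

context complex_inner_space
begin

lemma carrier_complex_ring [simp]: "a \<in> carrier complex_ring"
  by (simp add: ring_of_type_algebra_def)

lemma cinner_add_right:
  assumes "x \<in> carrier H" "y \<in> carrier H" "z \<in> carrier H"
  shows "cinner H x (y \<oplus> z) = cinner H x y + cinner H x z"
  using assms by (simp add: cinner_cnj[of _ x] cinner_add_left)

lemma cinner_smult_right:
  assumes "x \<in> carrier H" "y \<in> carrier H"
  shows "cinner H x (a \<odot> y) = cnj a * cinner H x y"
  using assms by (simp add: cinner_cnj[of _ x] cinner_smult_left)

lemma cinner_self: "x \<in> carrier H \<Longrightarrow> cinner H x x = of_real ((hnorm H x)\<^sup>2)"
  using cinner_cnj[of x x] cinner_nonneg[of x] by (simp add: hnorm_def complex_eq_iff)

lemma hnorm_nonneg: "x \<in> carrier H \<Longrightarrow> 0 \<le> hnorm H x"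
  by (simp add: hnorm_def cinner_nonneg)

lemma hnorm_smult: "x \<in> carrier H \<Longrightarrow> hnorm H (a \<odot> x) = cmod a * hnorm H x"
proof -
  assume x: "x \<in> carrier H"
  have "complex_of_real ((hnorm H (a \<odot> x))\<^sup>2) = cinner H (a \<odot> x) (a \<odot> x)"
    using x by (intro cinner_self[symmetric]) simp
  also have "\<dots> = (a * cnj a) * of_real ((hnorm H x)\<^sup>2)"
    unfolding cinner_self[OF x, symmetric]
    using x by (simp add: cinner_smult_left cinner_smult_right)
  also have "\<dots> = of_real ((cmod a * hnorm H x)\<^sup>2)"
    by (simp add: complex_norm_square[symmetric] power_mult_distrib)
  finally have "complex_of_real ((hnorm H (a \<odot> x))\<^sup>2) = of_real ((cmod a * hnorm H x)\<^sup>2)" .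
  then have "(hnorm H (a \<odot> x))\<^sup>2 = (cmod a * hnorm H x)\<^sup>2"
    by (simp only: of_real_eq_iff)
  then show ?thesis
    using x by (simp add: power2_eq_iff_nonneg hnorm_nonneg)
qed

lemma hnorm_add_sq:
  assumes "x \<in> carrier H" "y \<in> carrier H"
  shows "(hnorm H (x \<oplus> y))\<^sup>2 = (hnorm H x)\<^sup>2 + 2 * Re (cinner H x y) + (hnorm H y)\<^sup>2"
proof -
  have "complex_of_real ((hnorm H (x \<oplus> y))\<^sup>2)
      = of_real ((hnorm H x)\<^sup>2) + (cinner H x y + cnj (cinner H x y)) + of_real ((hnorm H y)\<^sup>2)"
    using assms cinner_cnj[of x y]
    by (simp only: cinner_self[symmetric] M.add.m_closed)
      (simp add: cinner_add_left cinner_add_right algebra_simps)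
  also have "\<dots> = of_real ((hnorm H x)\<^sup>2 + 2 * Re (cinner H x y) + (hnorm H y)\<^sup>2)"
    by (simp add: complex_add_cnj)
  finally show ?thesis by (simp only: of_real_eq_iff)
qed

lemma hnorm_eq_0: "x \<in> carrier H \<Longrightarrow> hnorm H x = 0 \<longleftrightarrow> x = \<zero>"
proof
  assume x: "x \<in> carrier H" and "hnorm H x = 0"
  then have "cinner H x x = 0" by (simp add: cinner_self)
  with x show "x = \<zero>" by (rule cinner_definite)
next
  assume "x \<in> carrier H" "x = \<zero>"
  then show "hnorm H x = 0"
    using hnorm_smult[of "\<zero>" 0] smult_r_null[of 0] by simp
qed

lemma Re_cinner_le:
  assumes "x \<in> carrier H" "y \<in> carrier H"
  shows "Re (cinner H x y) \<le> hnorm H x * hnorm H y"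
proof (cases "x = \<zero> \<or> y = \<zero>")
  case True
  have "cinner H \<zero> y = 0" "cinner H x \<zero> = 0"
    using assms cinner_smult_left[of \<zero> y 0] cinner_smult_right[of x \<zero> 0]
    by (simp_all add: smult_r_null)
  with True show ?thesis using assms by (auto simp: hnorm_nonneg)
next
  case False
  define a b where "a = hnorm H x" and "b = hnorm H y"
  have pos: "a > 0" "b > 0"
    using False assms hnorm_nonneg[of x] hnorm_nonneg[of y] hnorm_eq_0[of x] hnorm_eq_0[of y]
    unfolding a_def b_def by linarith+
  define u v where "u = complex_of_real b \<odot> x" and "v = complex_of_real (- a) \<odot> y"
  have uv: "u \<in> carrier H" "v \<in> carrier H"
    using assms by (auto simp: u_def v_def)
  have n: "hnorm H u = b * a" "hnorm H v = a * b"
    using assms pos by (simp_all add: u_def v_def hnorm_smult a_def b_def)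
  have r: "Re (cinner H u v) = - (a * b) * Re (cinner H x y)"
    using assms by (simp add: u_def v_def cinner_smult_left cinner_smult_right)
  have "0 \<le> (hnorm H (u \<oplus> v))\<^sup>2" by simp
  also have "\<dots> = 2 * (a * b) * (a * b - Re (cinner H x y))"
    unfolding hnorm_add_sq[OF uv] n r by (simp add: power2_eq_square algebra_simps)
  finally have "0 \<le> a * b - Re (cinner H x y)"
    using mult_pos_pos[OF pos] by (simp add: zero_le_mult_iff del: mult_pos_pos)
  then show ?thesis by (simp add: a_def b_def)
qed

lemma hnorm_triangle:
  assumes "x \<in> carrier H" "y \<in> carrier H"
  shows "hnorm H (x \<oplus> y) \<le> hnorm H x + hnorm H y"
proof (rule power2_le_imp_le)
  show "(hnorm H (x \<oplus> y))\<^sup>2 \<le> (hnorm H x + hnorm H y)\<^sup>2"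
    unfolding hnorm_add_sq[OF assms] using Re_cinner_le[OF assms]
    by (simp add: power2_eq_square algebra_simps)
  show "0 \<le> hnorm H x + hnorm H y" using assms by (simp add: hnorm_nonneg)
qed

lemma hnorm_uminus:
  assumes "x \<in> carrier H" shows "hnorm H (\<ominus> x) = hnorm H x"
proof -
  have c: "\<ominus> x \<in> carrier H" using assms by simp
  have "(hnorm H (x \<oplus> \<ominus> x))\<^sup>2 = 0"
    using assms by (simp add: M.r_neg hnorm_eq_0)
  moreover have z: "cinner H x (\<ominus> x) + cinner H x x = 0"
    using cinner_add_right[of x "\<ominus> x" x] cinner_smult_right[of x \<zero> 0] assms c
    by (simp add: M.l_neg smult_r_null)
  ultimately have "(hnorm H (\<ominus> x))\<^sup>2 = (hnorm H x)\<^sup>2"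
    using hnorm_add_sq[OF assms c] cinner_self[OF assms]
    by (auto simp: complex_eq_iff)
  then show ?thesis using assms c by (simp add: power2_eq_iff_nonneg hnorm_nonneg)
qed

lemma Metric_space_hdist: "Metric_space (carrier H) (hdist H)"
proof
  fix x y
  show "0 \<le> hdist H x y" by (simp add: hdist_def hnorm_nonneg)
  show "hdist H x y = hdist H y x"
  proof (cases "x \<in> carrier H \<and> y \<in> carrier H")
    case True
    then have "\<ominus> (x \<ominus> y) = y \<ominus> x"
      by (simp add: M.minus_eq M.minus_add M.a_comm)
    with True show ?thesis
      using hnorm_uminus[of "x \<ominus> y"] by (simp add: hdist_def)
  qed (auto simp: hdist_def)
  assume "x \<in> carrier H" "y \<in> carrier H"
  then show "hdist H x y = 0 \<longleftrightarrow> x = y"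
    using M.minus_equality[of x "\<ominus> y"]
    by (auto simp: hdist_def hnorm_eq_0 M.minus_eq M.r_neg)
next
  fix x y z
  assume xyz: "x \<in> carrier H" "y \<in> carrier H" "z \<in> carrier H"
  have "x \<ominus> z = (x \<ominus> y) \<oplus> (y \<ominus> z)"
    using xyz by (simp add: M.minus_eq M.a_assoc M.r_neg1)
  then show "hdist H x z \<le> hdist H x y + hdist H y z"
    using xyz hnorm_triangle[of "x \<ominus> y" "y \<ominus> z"] by (simp add: hdist_def)
qed

end

sublocale complex_inner_space \<subseteq> Metric_space "carrier H" "hdist H"
  by (rule Metric_space_hdist)

locale hilbert_space = complex_inner_space +
  assumes complete: mcomplete

text \<open>The values of the maps below outside the carriers are irrelevant.\<close>

definition linear_op :: "'a inner_space \<Rightarrow> 'b inner_space \<Rightarrow> ('a \<Rightarrow> 'b) \<Rightarrow> bool"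
  where "linear_op H K T \<longleftrightarrow>
    T \<in> carrier H \<rightarrow> carrier K \<and>
    (\<forall>x\<in>carrier H. \<forall>y\<in>carrier H. T (x \<oplus>\<^bsub>H\<^esub> y) = T x \<oplus>\<^bsub>K\<^esub> T y) \<and>
    (\<forall>a. \<forall>x\<in>carrier H. T (a \<odot>\<^bsub>H\<^esub> x) = a \<odot>\<^bsub>K\<^esub> T x)"

definition bounded_op :: "'a inner_space \<Rightarrow> 'b inner_space \<Rightarrow> ('a \<Rightarrow> 'b) \<Rightarrow> bool"
  where "bounded_op H K T \<longleftrightarrow>
    linear_op H K T \<and> (\<exists>B. \<forall>x\<in>carrier H. hnorm K (T x) \<le> B * hnorm H x)"

definition op_norm :: "'a inner_space \<Rightarrow> 'b inner_space \<Rightarrow> ('a \<Rightarrow> 'b) \<Rightarrow> real"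
  where "op_norm H K T = (SUP x \<in> {x \<in> carrier H. hnorm H x \<le> 1}. hnorm K (T x))"

definition contraction :: "'a inner_space \<Rightarrow> ('a \<Rightarrow> 'a) \<Rightarrow> bool"
  where "contraction H T \<longleftrightarrow> bounded_op H H T \<and> op_norm H H T \<le> 1"

definition isometry :: "'a inner_space \<Rightarrow> 'b inner_space \<Rightarrow> ('a \<Rightarrow> 'b) \<Rightarrow> bool"
  where "isometry H K V \<longleftrightarrow>
    linear_op H K V \<and> (\<forall>x\<in>carrier H. hnorm K (V x) = hnorm H x)"

definition q_commute :: "'a inner_space \<Rightarrow> complex \<Rightarrow> ('a \<Rightarrow> 'a) \<Rightarrow> ('a \<Rightarrow> 'a) \<Rightarrow> bool"
  where "q_commute H q S T \<longleftrightarrow> (\<forall>x\<in>carrier H. S (T x) = q \<odot>\<^bsub>H\<^esub> T (S x))"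

text \<open>
  The description determines a unique vector whenever \<open>S\<close> is a closed subspace of a Hilbert space,
  in particular when \<open>S\<close> is the range of an isometry between Hilbert spaces.
\<close>

definition orth_proj :: "'a inner_space \<Rightarrow> 'a set \<Rightarrow> 'a \<Rightarrow> 'a"
  where "orth_proj K S x = (THE y. y \<in> S \<and> (\<forall>z\<in>S. cinner K (x \<ominus>\<^bsub>K\<^esub> y) z = 0))"

text \<open>
  An existential statement in HOL has to name the type of the witness.  If the vectors of a space
  \<open>H\<close> have type \<open>'a\<close>, then the closed span of countably many images of \<open>H\<close> has Hilbert dimension at
  most the cardinality of \<open>nat \<times> 'a\<close>, so up to unitary equivalence it is a space of
  square-summable families of the following type.
\<close>

type_synonym 'a big = "nat \<times> 'a \<Rightarrow> complex"

end

(*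
Ando's dilation, twisted by q.  On K = H + F + F + ... (an orthogonal sum) put
V_i (h, y0, y1, ...) = (T_i h, D_i h, y0, y1, ...), where the defect maps D_i : H -> F have
orthogonal ranges and norm (D_i h)^2 = norm h^2 - norm (T_i h)^2.  Each V_i is an isometry that
compresses to T_i, but V_1 V_2 and q V_2 V_1 send h to vectors whose two first F-components,
c h and q d h, are different.  These components are orthogonal to each other and have the same
Gram matrix, so the reflection along all c h - q d h exchanges them.  With G the unitary that acts
on the n-th pair of copies of F by q^n times this reflection, G V_1 V_2 = q V_2 V_1 G, and
therefore G V_1 and V_2 G^(-1) are q-commuting isometries.  Both leave the orthogonal complement
of H invariant, so products of their powers compress to products of powers of the T_i.
*)

theory Submission
  imports Defs "HOL-Library.Function_Algebras"
begin

section \<open>Hilbert spaces inside complex vector spaces\<close>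

text \<open>The assignment of q d h to c h is only an isometry between two subspaces, and extending
  such a map to a unitary would in general require complements of equal dimension. Orthogonal defect
  ranges remove this obstacle: they make every c h orthogonal to every d h', so the assignment
  extends to a reflection of the whole space, whatever the dimensions are. The powers of q are
  forced. Past the components c h and d h, both V_1 V_2 and V_2 V_1 act as the double shift, so G
  must turn the double shift into q times itself. As G is the bare reflection on the first pair of
  levels, each further pair picks up one more factor q. Levels come in pairs because c h and d h
  each fill two consecutive ones. Only the norms of D_i h matter, not the space in which they lie. F
  may therefore consist of sequences, and D_i h lists vectors whose squared norms add up to the
  required defect; this replaces a square root of 1 - T_i^* T_i.\<close>

class complex_vector = ab_group_add +
  fixes scaleC :: "complex \<Rightarrow> 'a \<Rightarrow> 'a"  (infixr \<open>*\<^sub>C\<close> 75)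
  assumes scaleC_right_distrib: "a *\<^sub>C (x + y) = a *\<^sub>C x + a *\<^sub>C y"
    and scaleC_left_distrib: "(a + b) *\<^sub>C x = a *\<^sub>C x + b *\<^sub>C x"
    and scaleC_scaleC [simp]: "a *\<^sub>C b *\<^sub>C x = (a * b) *\<^sub>C x"
    and scaleC_one [simp]: "1 *\<^sub>C x = x"
begin

lemma scaleC_zero_left [simp]: "0 *\<^sub>C x = 0"
  using scaleC_left_distrib[of 0 0 x] by simp

lemma scaleC_zero_right [simp]: "a *\<^sub>C 0 = 0"
  using scaleC_right_distrib[of a 0 0] by simp

lemma scaleC_minus_left: "(- a) *\<^sub>C x = - (a *\<^sub>C x)"
  using scaleC_left_distrib[of "- a" a x] by (simp add: eq_neg_iff_add_eq_0)

lemma scaleC_minus_right: "a *\<^sub>C (- x) = - (a *\<^sub>C x)"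
  using scaleC_right_distrib[of a "- x" x] by (simp add: eq_neg_iff_add_eq_0)

lemma scaleC_right_diff_distrib: "a *\<^sub>C (x - y) = a *\<^sub>C x - a *\<^sub>C y"
  using scaleC_right_distrib[of a x "- y"] by (simp add: scaleC_minus_right)

end

instantiation complex :: complex_vector
begin
definition "scaleC a (x :: complex) = a * x"
instance by standard (simp_all add: scaleC_complex_def algebra_simps)
end

instantiation "fun" :: (type, complex_vector) complex_vector
begin
definition "scaleC a f = (\<lambda>i. a *\<^sub>C f i)"
instance by standard
    (simp_all add: scaleC_fun_def fun_eq_iff scaleC_right_distrib scaleC_left_distrib)
end

lemma scaleC_fun_apply [simp]: "(a *\<^sub>C f) i = a *\<^sub>C f i"
  by (simp add: scaleC_fun_def)

definition linear_map :: "'a::complex_vector set \<Rightarrow> 'b::complex_vector set \<Rightarrow> ('a \<Rightarrow> 'b) \<Rightarrow> bool"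
  where "linear_map S S' f \<longleftrightarrow>
    (\<forall>x\<in>S. f x \<in> S') \<and> (\<forall>x\<in>S. \<forall>y\<in>S. f (x + y) = f x + f y) \<and>
    (\<forall>a. \<forall>x\<in>S. f (a *\<^sub>C x) = a *\<^sub>C f x)"

lemma linear_mapI:
  assumes "\<And>x. x \<in> S \<Longrightarrow> f x \<in> S'"
    and "\<And>x y. x \<in> S \<Longrightarrow> y \<in> S \<Longrightarrow> f (x + y) = f x + f y"
    and "\<And>a x. x \<in> S \<Longrightarrow> f (a *\<^sub>C x) = a *\<^sub>C f x"
  shows "linear_map S S' f"
  using assms by (auto simp: linear_map_def)

lemma
  assumes "linear_map S S' f"
  shows linear_map_mem: "x \<in> S \<Longrightarrow> f x \<in> S'"
    and linear_map_add: "x \<in> S \<Longrightarrow> y \<in> S \<Longrightarrow> f (x + y) = f x + f y"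
    and linear_map_scale: "x \<in> S \<Longrightarrow> f (a *\<^sub>C x) = a *\<^sub>C f x"
  using assms by (auto simp: linear_map_def)

lemma linear_map_comp:
  "linear_map S S' f \<Longrightarrow> linear_map S' S'' g \<Longrightarrow> linear_map S S'' (\<lambda>x. g (f x))"
  by (simp add: linear_map_def)

text \<open>A carrier set inside a type with total vector operations keeps the algebra free of side
  conditions. Square-summable families are again such a set, inside a function type, so the same
  locale serves \<open>H\<close> and its dilation space.\<close>

locale hilbert =
  fixes S :: "'v::complex_vector set" and ip :: "'v \<Rightarrow> 'v \<Rightarrow> complex"
  assumes zero_mem [simp]: "0 \<in> S"
    and add_mem [simp]: "x \<in> S \<Longrightarrow> y \<in> S \<Longrightarrow> x + y \<in> S"
    and scale_mem [simp]: "x \<in> S \<Longrightarrow> a *\<^sub>C x \<in> S"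
    and ip_add_left: "x \<in> S \<Longrightarrow> y \<in> S \<Longrightarrow> z \<in> S \<Longrightarrow> ip (x + y) z = ip x z + ip y z"
    and ip_scale_left: "x \<in> S \<Longrightarrow> y \<in> S \<Longrightarrow> ip (a *\<^sub>C x) y = a * ip x y"
    and ip_cnj: "x \<in> S \<Longrightarrow> y \<in> S \<Longrightarrow> ip y x = cnj (ip x y)"
    and ip_nonneg: "x \<in> S \<Longrightarrow> 0 \<le> Re (ip x x)"
    and ip_definite: "x \<in> S \<Longrightarrow> ip x x = 0 \<Longrightarrow> x = 0"
    and Cauchy_convergent: "(\<And>n::nat. \<sigma> n \<in> S)
      \<Longrightarrow> (\<And>e. 0 < e \<Longrightarrow> \<exists>M. \<forall>m\<ge>M. \<forall>n\<ge>M. sqrt (Re (ip (\<sigma> m - \<sigma> n) (\<sigma> m - \<sigma> n))) < e)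
      \<Longrightarrow> \<exists>l\<in>S. (\<lambda>n. sqrt (Re (ip (\<sigma> n - l) (\<sigma> n - l)))) \<longlonglongrightarrow> 0"
begin

definition nrm :: "'v \<Rightarrow> real" where "nrm x = sqrt (Re (ip x x))"

lemma uminus_mem [simp]: "x \<in> S \<Longrightarrow> - x \<in> S"
  using scale_mem[of x "- 1"] by (simp add: scaleC_minus_left)

lemma diff_mem [simp]: "x \<in> S \<Longrightarrow> y \<in> S \<Longrightarrow> x - y \<in> S"
  using add_mem[of x "- y"] by simp

lemma ip_add_right: "x \<in> S \<Longrightarrow> y \<in> S \<Longrightarrow> z \<in> S \<Longrightarrow> ip x (y + z) = ip x y + ip x z"
  using ip_cnj[of _ x] by (simp add: ip_add_left)

lemma ip_scale_right: "x \<in> S \<Longrightarrow> y \<in> S \<Longrightarrow> ip x (a *\<^sub>C y) = cnj a * ip x y"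
  using ip_cnj[of _ x] by (simp add: ip_scale_left)

lemma ip_zero [simp]: "x \<in> S \<Longrightarrow> ip 0 x = 0" "x \<in> S \<Longrightarrow> ip x 0 = 0"
  using ip_scale_left[of 0 x 0] ip_scale_right[of x 0 0] by simp_all

lemma ip_minus_left: "x \<in> S \<Longrightarrow> y \<in> S \<Longrightarrow> ip (- x) y = - ip x y"
  using ip_scale_left[of x y "- 1"] by (simp add: scaleC_minus_left)

lemma ip_minus_right: "x \<in> S \<Longrightarrow> y \<in> S \<Longrightarrow> ip x (- y) = - ip x y"
  using ip_scale_right[of x y "- 1"] by (simp add: scaleC_minus_left)

lemma ip_diff_left: "x \<in> S \<Longrightarrow> y \<in> S \<Longrightarrow> z \<in> S \<Longrightarrow> ip (x - y) z = ip x z - ip y z"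
  using ip_add_left[of x "- y" z] by (simp add: ip_minus_left)

lemma ip_diff_right: "x \<in> S \<Longrightarrow> y \<in> S \<Longrightarrow> z \<in> S \<Longrightarrow> ip x (y - z) = ip x y - ip x z"
  using ip_add_right[of x y "- z"] by (simp add: ip_minus_right)

lemmas ip_linear = ip_add_left ip_add_right ip_diff_left ip_diff_right ip_scale_left ip_scale_right
  ip_minus_left ip_minus_right

lemma nrm_sq: "x \<in> S \<Longrightarrow> (nrm x)\<^sup>2 = Re (ip x x)"
  by (simp add: nrm_def ip_nonneg)

lemma ip_self: "x \<in> S \<Longrightarrow> ip x x = of_real ((nrm x)\<^sup>2)"
  using ip_cnj[of x x] by (simp add: nrm_sq complex_eq_iff)

lemma nrm_nonneg [simp]: "x \<in> S \<Longrightarrow> 0 \<le> nrm x"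
  by (simp add: nrm_def ip_nonneg)

lemma nrm_eq_0: "x \<in> S \<Longrightarrow> nrm x = 0 \<longleftrightarrow> x = 0"
  using ip_definite[of x] by (auto simp: ip_self) (simp add: nrm_def)

lemma nrm_zero [simp]: "nrm 0 = 0"
  by (simp add: nrm_eq_0)

lemma nrm_add_sq:
  assumes "x \<in> S" "y \<in> S"
  shows "(nrm (x + y))\<^sup>2 = (nrm x)\<^sup>2 + 2 * Re (ip x y) + (nrm y)\<^sup>2"
  using assms ip_cnj[of x y] by (simp add: nrm_sq ip_linear)

lemma nrm_diff_sq:
  assumes "x \<in> S" "y \<in> S"
  shows "(nrm (x - y))\<^sup>2 = (nrm x)\<^sup>2 - 2 * Re (ip x y) + (nrm y)\<^sup>2"
  using assms ip_cnj[of x y] by (simp add: nrm_sq ip_linear)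

lemma nrm_scale: "x \<in> S \<Longrightarrow> nrm (a *\<^sub>C x) = cmod a * nrm x"
proof -
  assume x: "x \<in> S"
  have "complex_of_real ((nrm (a *\<^sub>C x))\<^sup>2) = (a * cnj a) * ip x x"
    using x ip_self[of "a *\<^sub>C x"] by (simp add: ip_linear mult_ac)
  also have "\<dots> = of_real ((cmod a * nrm x)\<^sup>2)"
    by (simp only: complex_norm_square[symmetric] ip_self[OF x] of_real_mult[symmetric]
        power_mult_distrib)
  finally have "complex_of_real ((nrm (a *\<^sub>C x))\<^sup>2) = of_real ((cmod a * nrm x)\<^sup>2)" .
  then have "(nrm (a *\<^sub>C x))\<^sup>2 = (cmod a * nrm x)\<^sup>2" by (simp only: of_real_eq_iff)
  then show ?thesis using x by (simp add: power2_eq_iff_nonneg)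
qed

lemma nrm_minus_commute: "x \<in> S \<Longrightarrow> y \<in> S \<Longrightarrow> nrm (x - y) = nrm (y - x)"
  using nrm_scale[of "x - y" "-1"] by (simp add: scaleC_minus_left)

lemma Cauchy_Schwarz:
  assumes x: "x \<in> S" and y: "y \<in> S"
  shows "cmod (ip x y) \<le> nrm x * nrm y"
proof (cases "y = 0")
  case True
  then show ?thesis using x by simp
next
  case False
  then have py: "nrm y > 0" using y nrm_eq_0[of y] nrm_nonneg[of y] by linarith
  define a where "a = ip x y / ip y y"
  have z: "a *\<^sub>C y \<in> S" using y by simp
  have cm: "cmod (ip y y) = (nrm y)\<^sup>2" using ip_self[OF y] by (simp only: norm_of_real) simp
  have "0 \<le> (nrm (x - a *\<^sub>C y))\<^sup>2" by simp
  also have "\<dots> = (nrm x)\<^sup>2 - 2 * Re (cnj a * ip x y) + (cmod a * nrm y)\<^sup>2"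
    using x y by (simp only: nrm_diff_sq z nrm_scale ip_linear)
  also have "cnj a * ip x y = of_real ((cmod (ip x y))\<^sup>2 / (nrm y)\<^sup>2)"
    unfolding a_def ip_self[OF y] of_real_divide complex_norm_square[of "ip x y"] by simp
  also have "(cmod a * nrm y)\<^sup>2 = (cmod (ip x y))\<^sup>2 / (nrm y)\<^sup>2"
    using py by (simp add: a_def norm_divide cm power2_eq_square)
  finally have "(cmod (ip x y))\<^sup>2 / (nrm y)\<^sup>2 \<le> (nrm x)\<^sup>2" by simp
  then have "(cmod (ip x y))\<^sup>2 \<le> (nrm x * nrm y)\<^sup>2"
    using py by (simp add: pos_divide_le_eq power_mult_distrib)
  then show ?thesis using x y by (meson mult_nonneg_nonneg nrm_nonneg power2_le_imp_le)
qed

lemma Re_ip_le: "x \<in> S \<Longrightarrow> y \<in> S \<Longrightarrow> Re (ip x y) \<le> nrm x * nrm y"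
  using Cauchy_Schwarz[of x y] complex_Re_le_cmod order_trans by blast

lemma nrm_triangle:
  assumes "x \<in> S" "y \<in> S"
  shows "nrm (x + y) \<le> nrm x + nrm y"
proof (rule power2_le_imp_le)
  show "(nrm (x + y))\<^sup>2 \<le> (nrm x + nrm y)\<^sup>2"
    unfolding nrm_add_sq[OF assms] using Re_ip_le[OF assms]
    by (simp add: power2_eq_square algebra_simps)
qed (use assms in simp)

lemma Cauchy_convergent_nrm:
  assumes "\<And>n::nat. \<sigma> n \<in> S"
    and "\<And>e. 0 < e \<Longrightarrow> \<exists>M. \<forall>m\<ge>M. \<forall>n\<ge>M. nrm (\<sigma> m - \<sigma> n) < e"
  obtains l where "l \<in> S" "(\<lambda>n. nrm (\<sigma> n - l)) \<longlonglongrightarrow> 0"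
proof -
  have "\<exists>l\<in>S. (\<lambda>n. nrm (\<sigma> n - l)) \<longlonglongrightarrow> 0"
    unfolding nrm_def by (rule Cauchy_convergent) (use assms in \<open>simp_all add: nrm_def\<close>)
  then show ?thesis using that by blast
qed

lemma nrm_tendsto:
  assumes "\<And>n::nat. \<sigma> n \<in> S" "l \<in> S" "(\<lambda>n. nrm (\<sigma> n - l)) \<longlonglongrightarrow> 0"
  shows "(\<lambda>n. nrm (\<sigma> n)) \<longlonglongrightarrow> nrm l"
proof (rule Lim_transform2)
  show "(\<lambda>n. nrm l) \<longlonglongrightarrow> nrm l" by simp
  have "\<bar>nrm l - nrm (\<sigma> n)\<bar> \<le> nrm (\<sigma> n - l)" for n
    using nrm_triangle[of "\<sigma> n - l" l] nrm_triangle[of "l - \<sigma> n" "\<sigma> n"] nrm_minus_commute[of l "\<sigma> n"]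
      assms(1)[of n] assms(2) by (simp add: abs_le_iff)
  then have "\<forall>\<^sub>F n in sequentially. norm (nrm l - nrm (\<sigma> n)) \<le> nrm (\<sigma> n - l)" by simp
  then show "(\<lambda>n. nrm l - nrm (\<sigma> n)) \<longlonglongrightarrow> 0"
    using assms(3) by (rule Lim_null_comparison)
qed

lemma ip_tendsto:
  assumes "\<And>n::nat. \<sigma> n \<in> S" "l \<in> S" "(\<lambda>n. nrm (\<sigma> n - l)) \<longlonglongrightarrow> 0" "y \<in> S"
  shows "(\<lambda>n. ip (\<sigma> n) y) \<longlonglongrightarrow> ip l y"
proof (rule Lim_transform2)
  show "(\<lambda>n. ip l y) \<longlonglongrightarrow> ip l y" by simp
  have "cmod (ip l y - ip (\<sigma> n) y) \<le> nrm (\<sigma> n - l) * nrm y" for n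
    using Cauchy_Schwarz[of "l - \<sigma> n" y] assms(1)[of n] assms(2,4) nrm_minus_commute[of l "\<sigma> n"]
    by (simp add: ip_linear)
  then have "\<forall>\<^sub>F n in sequentially. cmod (ip l y - ip (\<sigma> n) y) \<le> nrm (\<sigma> n - l) * nrm y" by simp
  moreover have "(\<lambda>n. nrm (\<sigma> n - l) * nrm y) \<longlonglongrightarrow> 0"
    using tendsto_mult[OF assms(3) tendsto_const[of "nrm y"]] by simp
  ultimately show "(\<lambda>n. ip l y - ip (\<sigma> n) y) \<longlonglongrightarrow> 0"
    by (rule Lim_null_comparison)
qed

section \<open>Closed subspaces and orthogonal projection\<close>

definition closed_subspace :: "'v set \<Rightarrow> bool"
  where "closed_subspace L \<longleftrightarrow> L \<subseteq> S \<and> 0 \<in> L \<and> (\<forall>x\<in>L. \<forall>y\<in>L. x + y \<in> L) \<and>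
    (\<forall>a. \<forall>x\<in>L. a *\<^sub>C x \<in> L) \<and>
    (\<forall>\<sigma> l. (\<forall>n::nat. \<sigma> n \<in> L) \<longrightarrow> l \<in> S \<longrightarrow> (\<lambda>n. nrm (\<sigma> n - l)) \<longlonglongrightarrow> 0 \<longrightarrow> l \<in> L)"

lemma parallelogram:
  "x \<in> S \<Longrightarrow> y \<in> S \<Longrightarrow> (nrm (x + y))\<^sup>2 + (nrm (x - y))\<^sup>2 = 2 * (nrm x)\<^sup>2 + 2 * (nrm y)\<^sup>2"
  by (simp add: nrm_add_sq nrm_diff_sq)

theorem projection_exists:
  assumes L: "closed_subspace L" and x: "x \<in> S"
  obtains p where "p \<in> L" "\<And>l. l \<in> L \<Longrightarrow> ip (x - p) l = 0"
proof -
  have LS: "\<And>l. l \<in> L \<Longrightarrow> l \<in> S" and L0: "0 \<in> L"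
    and Ladd: "\<And>l m. l \<in> L \<Longrightarrow> m \<in> L \<Longrightarrow> l + m \<in> L" and Lsc: "\<And>a l. l \<in> L \<Longrightarrow> a *\<^sub>C l \<in> L"
    using L by (simp_all add: closed_subspace_def subset_eq)
  have Lcl: "\<And>\<sigma> l. (\<And>n::nat. \<sigma> n \<in> L) \<Longrightarrow> l \<in> S \<Longrightarrow> (\<lambda>n. nrm (\<sigma> n - l)) \<longlonglongrightarrow> 0 \<Longrightarrow> l \<in> L"
    using L unfolding closed_subspace_def by blast
  define d where "d = (INF l\<in>L. (nrm (x - l))\<^sup>2)"
  have bdd: "bdd_below ((\<lambda>l. (nrm (x - l))\<^sup>2) ` L)" by (rule bdd_belowI[of _ 0]) auto
  have d_le: "d \<le> (nrm (x - l))\<^sup>2" if "l \<in> L" for l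
    unfolding d_def using that by (intro cINF_lower[OF bdd])
  have "\<exists>l\<in>L. (nrm (x - l))\<^sup>2 < d + 1 / real (Suc n)" for n
  proof -
    have "Inf ((\<lambda>l. (nrm (x - l))\<^sup>2) ` L) < d + 1 / real (Suc n)" by (simp add: d_def)
    then show ?thesis using cInf_lessD[of "(\<lambda>l. (nrm (x - l))\<^sup>2) ` L"] L0 by blast
  qed
  then obtain \<sigma> where XL: "\<And>n. \<sigma> n \<in> L" and Xd: "\<And>n. (nrm (x - \<sigma> n))\<^sup>2 < d + 1 / real (Suc n)"
    by metis
  have XS: "\<sigma> n \<in> S" for n using XL LS by blast
  \<comment> \<open>Parallelogram law for \<open>x - \<sigma> n\<close> and
    \<open>x - \<sigma> m\<close>: their sum is twice the vector from the midpoint to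
    \<open>x\<close>, and the midpoint lies in \<open>L\<close>, so its squared distance is at least
    \<open>d\<close>.\<close>
  have dist: "(nrm (\<sigma> m - \<sigma> n))\<^sup>2 \<le> 2 / real (Suc m) + 2 / real (Suc n)" for m n
  proof -
    have mid: "(1/2) *\<^sub>C (\<sigma> m + \<sigma> n) \<in> L" using XL Ladd Lsc by blast
    have "(x - \<sigma> n) + (x - \<sigma> m) = 2 *\<^sub>C (x - (1/2) *\<^sub>C (\<sigma> m + \<sigma> n))"
      using scaleC_left_distrib[of 1 1 x]
      by (simp add: scaleC_right_diff_distrib algebra_simps)
    then have "(nrm ((x - \<sigma> n) + (x - \<sigma> m)))\<^sup>2 = 4 * (nrm (x - (1/2) *\<^sub>C (\<sigma> m + \<sigma> n)))\<^sup>2"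
      using x XS by (simp add: nrm_scale power_mult_distrib)
    moreover have "(x - \<sigma> n) - (x - \<sigma> m) = \<sigma> m - \<sigma> n" by simp
    ultimately show ?thesis
      using parallelogram[of "x - \<sigma> n" "x - \<sigma> m"] x XS Xd[of m] Xd[of n] d_le[OF mid] by simp
  qed
  have "\<exists>M. \<forall>m\<ge>M. \<forall>n\<ge>M. nrm (\<sigma> m - \<sigma> n) < e" if e: "0 < e" for e
  proof -
    \<comment> \<open>Both summands of \<open>dist\<close> have to drop below
      \<open>e\<^sup>2 / 2\<close>.\<close>
    obtain M :: nat where M: "4 / e\<^sup>2 < real M" using reals_Archimedean2 by blast
    have "nrm (\<sigma> m - \<sigma> n) < e" if "m \<ge> M" "n \<ge> M" for m n
    proof -
      have "4 < e\<^sup>2 * real M" using M e by (simp add: field_simps)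
      have *: "2 / real (Suc k) < e\<^sup>2 / 2" if "k \<ge> M" for k
      proof -
        have "4 < e\<^sup>2 * real (Suc k)"
          using \<open>4 < e\<^sup>2 * real M\<close> that mult_left_mono[of "real M" "real (Suc k)" "e\<^sup>2"] by simp
        then show ?thesis by (simp add: field_simps)
      qed
      have "(nrm (\<sigma> m - \<sigma> n))\<^sup>2 < e\<^sup>2" using dist[of m n] *[OF that(1)] *[OF that(2)] by simp
      then show ?thesis using e by (simp add: power_less_imp_less_base)
    qed
    then show ?thesis by blast
  qed
  then obtain p where p: "p \<in> S" "(\<lambda>n. nrm (\<sigma> n - p)) \<longlonglongrightarrow> 0"
    using Cauchy_convergent_nrm[of \<sigma>] XS by blast
  have pL: "p \<in> L" using Lcl XL p by blast
  have "(\<lambda>n. nrm (x - \<sigma> n)) \<longlonglongrightarrow> nrm (x - p)"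
  proof (rule nrm_tendsto)
    have "x - \<sigma> n - (x - p) = p - \<sigma> n" for n by simp
    then show "(\<lambda>n. nrm (x - \<sigma> n - (x - p))) \<longlonglongrightarrow> 0"
      using p nrm_minus_commute[OF p(1) XS] by simp
  qed (use x XS p in auto)
  then have lim: "(\<lambda>n. (nrm (x - \<sigma> n))\<^sup>2) \<longlonglongrightarrow> (nrm (x - p))\<^sup>2" by (intro tendsto_intros)
  have "(\<lambda>n. d + 1 / real (Suc n)) \<longlonglongrightarrow> d + 0"
    using LIMSEQ_inverse_real_of_nat by (intro tendsto_intros) (simp add: inverse_eq_divide)
  then have "(nrm (x - p))\<^sup>2 \<le> d"
    using LIMSEQ_le[OF lim, of "\<lambda>n. d + 1 / real (Suc n)" d] less_imp_le[OF Xd] by simp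
  then have min: "(nrm (x - p))\<^sup>2 \<le> (nrm (x - l))\<^sup>2" if "l \<in> L" for l
    using d_le[OF that] by linarith
  have "ip (x - p) l = 0" if l: "l \<in> L" for l
  proof (cases "l = 0")
    case True
    then show ?thesis using x p by simp
  next
    case False
    have lS: "l \<in> S" using l LS by blast
    have nl: "nrm l > 0" using False lS nrm_eq_0[of l] nrm_nonneg[of l] by linarith
    define w where "w = ip (x - p) l"
    \<comment> \<open>The best multiple of \<open>l\<close>: moving \<open>p\<close> by
      \<open>a *\<^sub>C l\<close> lowers the squared distance by
      \<open>(cmod w)\<^sup>2 / (nrm l)\<^sup>2\<close>, which minimality permits only for
      \<open>w = 0\<close>.\<close>
    define a where "a = w / of_real ((nrm l)\<^sup>2)"
    have "p + a *\<^sub>C l \<in> L" using pL l Ladd Lsc by blast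
    then have "(nrm (x - p))\<^sup>2 \<le> (nrm ((x - p) - a *\<^sub>C l))\<^sup>2"
      using min[of "p + a *\<^sub>C l"] by (simp add: diff_diff_eq)
    also have "\<dots> = (nrm (x - p))\<^sup>2 - 2 * Re (cnj a * w) + (cmod a * nrm l)\<^sup>2"
      using x p lS by (subst nrm_diff_sq) (simp_all add: nrm_scale ip_linear w_def)
    also have "cnj a * w = of_real ((cmod w)\<^sup>2 / (nrm l)\<^sup>2)"
      unfolding a_def of_real_divide complex_norm_square[of w] by simp
    also have "(cmod a * nrm l)\<^sup>2 = (cmod w)\<^sup>2 / (nrm l)\<^sup>2"
      using nl by (simp add: a_def norm_divide norm_mult power2_eq_square)
    finally have "(cmod w)\<^sup>2 / (nrm l)\<^sup>2 \<le> 0" unfolding Re_complex_of_real by linarith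
    then have "w = 0" using nl by (simp add: divide_le_0_iff)
    then show ?thesis by (simp add: w_def)
  qed
  with pL show ?thesis using that by blast
qed

end

section \<open>Riesz representation and the defect of a contraction\<close>

context hilbert
begin

lemma ip_left_unique:
  assumes "x \<in> S" "y \<in> S" "\<And>z. z \<in> S \<Longrightarrow> ip z x = ip z y"
  shows "x = y"
proof -
  have "ip (x - y) (x - y) = 0" using assms by (simp add: ip_diff_right)
  then show ?thesis using assms ip_definite[of "x - y"] by simp
qed

text \<open>Boundedness makes the kernel \<open>N\<close> closed, and the component \<open>z\<close>
  of \<open>x0\<close> orthogonal to \<open>N\<close> represents the functional up to a
  scalar.\<close>

lemma Riesz_representation:
  assumes f: "linear_map S UNIV (f :: 'v \<Rightarrow> complex)"
    and bound: "\<And>x. x \<in> S \<Longrightarrow> cmod (f x) \<le> C * nrm x"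
  shows "\<exists>y\<in>S. \<forall>x\<in>S. f x = ip x y"
proof (cases "\<forall>x\<in>S. f x = 0")
  case True
  then show ?thesis by (intro bexI[of _ 0]) auto
next
  case False
  then obtain x0 where x0: "x0 \<in> S" "f x0 \<noteq> 0" by blast
  define N where "N = {x \<in> S. f x = 0}"
  have fadd: "f (x + y) = f x + f y" and fsc: "f (a *\<^sub>C x) = a * f x" if "x \<in> S" "y \<in> S" for x y a
    using linear_map_add[OF f] linear_map_scale[OF f] that by (simp_all add: scaleC_complex_def)
  have fdiff: "f (x - y) = f x - f y" if "x \<in> S" "y \<in> S" for x y
    using fadd[of "x - y" y] that by simp
  have lim: "l \<in> N" if "\<And>n::nat. \<sigma> n \<in> N" "l \<in> S" "(\<lambda>n. nrm (\<sigma> n - l)) \<longlonglongrightarrow> 0" for \<sigma> l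
  proof -
    have sS: "\<sigma> n \<in> S" "f (\<sigma> n) = 0" for n using that(1)[of n] by (auto simp: N_def)
    have "cmod (f l) \<le> C * nrm (\<sigma> n - l)" for n
      using bound[of "\<sigma> n - l"] sS that(2) by (simp add: fdiff)
    moreover have "(\<lambda>n. C * nrm (\<sigma> n - l)) \<longlonglongrightarrow> C * 0"
      using that(3) by (intro tendsto_intros)
    ultimately have "cmod (f l) \<le> C * 0"
      by (intro LIMSEQ_le_const) auto
    then show "l \<in> N" using that(2) by (simp add: N_def)
  qed
  have f0: "f 0 = 0" using fsc[of 0 0 0] by simp
  have "closed_subspace N"
    unfolding closed_subspace_def
  proof (intro conjI ballI allI impI)
    show "l \<in> N" if "\<forall>n::nat. \<sigma> n \<in> N" "l \<in> S" "(\<lambda>n. nrm (\<sigma> n - l)) \<longlonglongrightarrow> 0" for \<sigma> l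
      using lim that by blast
  qed (auto simp: N_def fadd fsc f0)
  then obtain p where p: "p \<in> N" "\<And>l. l \<in> N \<Longrightarrow> ip (x0 - p) l = 0"
    using projection_exists x0(1) by blast
  define z where "z = x0 - p"
  have pS: "p \<in> S" "f p = 0" using p by (auto simp: N_def)
  have z: "z \<in> S" "f z \<noteq> 0" using pS x0 by (simp_all add: z_def fdiff)
  have zN: "ip l z = 0" if "l \<in> N" for l
  proof -
    have "l \<in> S" using that by (simp add: N_def)
    then show ?thesis using p(2)[OF that] ip_cnj[of z l] z by (simp add: z_def)
  qed
  have zz: "ip z z \<noteq> 0" using ip_definite[OF z(1)] z(2) f0 by auto
  \<comment> \<open>Normalized by \<open>f z = ip z y\<close>; the conjugate offsets antilinearity
    of \<open>ip\<close> in its second argument.\<close>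
  define y where "y = cnj (f z / ip z z) *\<^sub>C z"
  have "f x = ip x y" if x: "x \<in> S" for x
  proof -
    have "f z *\<^sub>C x - f x *\<^sub>C z \<in> N" using x z by (simp add: N_def fdiff fsc mult.commute)
    then have "f z * ip x z = f x * ip z z"
      using zN x z by (fastforce simp: ip_linear)
    then show ?thesis using x z zz by (simp add: y_def ip_linear field_simps)
  qed
  moreover have "y \<in> S" using z by (simp add: y_def)
  ultimately show ?thesis by blast
qed

text \<open>\<open>A\<close> is T^* T, obtained by one application of Riesz to the functional
  \<open>\<lambda>z. ip (T z) (T x)\<close>, without first constructing T^*.\<close>

lemma gram_operator:
  assumes T: "linear_map S S T" and contr: "\<And>x. x \<in> S \<Longrightarrow> nrm (T x) \<le> nrm x"
  obtains A where "linear_map S S A" "\<And>x y. x \<in> S \<Longrightarrow> y \<in> S \<Longrightarrow> ip (A x) y = ip (T x) (T y)"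
proof -
  have "\<exists>w\<in>S. \<forall>z\<in>S. ip (T z) (T x) = ip z w" if x: "x \<in> S" for x
  proof (rule Riesz_representation)
    show "linear_map S UNIV (\<lambda>z. ip (T z) (T x))"
      using x T by (intro linear_mapI)
        (simp_all add: linear_map_add linear_map_mem linear_map_scale ip_linear scaleC_complex_def)
    show "cmod (ip (T z) (T x)) \<le> nrm (T x) * nrm z" if z: "z \<in> S" for z
      using Cauchy_Schwarz[of "T z" "T x"] contr[OF z] linear_map_mem[OF T] x z
      by (smt (verit) mult.commute mult_left_mono nrm_nonneg)
  qed
  then obtain A where A: "\<And>x. x \<in> S \<Longrightarrow> A x \<in> S"
    "\<And>x z. x \<in> S \<Longrightarrow> z \<in> S \<Longrightarrow> ip z (A x) = ip (T z) (T x)"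
    by metis
  have "linear_map S S A"
  proof (rule linear_mapI)
    fix x y a assume xy: "x \<in> S" "y \<in> S"
    show "A (x + y) = A x + A y"
      using xy T A by (intro ip_left_unique)
        (simp_all add: ip_linear linear_map_add linear_map_mem)
  next
    fix x a assume x: "x \<in> S"
    show "A (a *\<^sub>C x) = a *\<^sub>C A x"
      using x T A by (intro ip_left_unique)
        (simp_all add: ip_linear linear_map_scale linear_map_mem)
  qed (use A in simp)
  moreover have "ip (A x) y = ip (T x) (T y)" if "x \<in> S" "y \<in> S" for x y
    using A that ip_cnj[of y "A x"] ip_cnj[of "T y" "T x"] linear_map_mem[OF T] by simp
  ultimately show ?thesis using that by blast
qed

text \<open>
  The series \<open>1 - A = (\<Sum>j. (1 - A) A\<^sup>j (1 - A))\<close> with \<open>A = T\<^sup>* T\<close>, where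
  \<open>A\<^sup>2\<^sup>k = (A\<^sup>k)\<^sup>* A\<^sup>k\<close> and \<open>A\<^sup>2\<^sup>k\<^sup>+\<^sup>1 = (T A\<^sup>k)\<^sup>* (T A\<^sup>k)\<close>, replaces
  the square root of \<open>1 - A\<close>.
\<close>

lemma defect_sequence:
  assumes T: "linear_map S S T" and contr: "\<And>x. x \<in> S \<Longrightarrow> nrm (T x) \<le> nrm x"
  obtains B :: "nat \<Rightarrow> 'v \<Rightarrow> 'v" where "\<And>j. linear_map S S (B j)"
    "\<And>h. h \<in> S \<Longrightarrow> (\<lambda>j. (nrm (B j h))\<^sup>2) sums ((nrm h)\<^sup>2 - (nrm (T h))\<^sup>2)"
proof -
  obtain A where A: "linear_map S S A"
    and AT: "\<And>x y. x \<in> S \<Longrightarrow> y \<in> S \<Longrightarrow> ip (A x) y = ip (T x) (T y)"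
    using gram_operator[OF T contr] by blast
  have TS [simp]: "T x \<in> S" and AS [simp]: "A x \<in> S" if "x \<in> S" for x
    using that T A by (auto intro: linear_map_mem)
  have AT': "ip x (A y) = ip (T x) (T y)" if "x \<in> S" "y \<in> S" for x y
    using that AT[of y x] ip_cnj[of "A y" x] ip_cnj[of "T y" "T x"] by simp
  have powS [simp]: "(A ^^ k) x \<in> S" if "x \<in> S" for k x
    using that by (induction k) auto
  have pow_lin: "linear_map S S (A ^^ k)" for k
  proof (induction k)
    case 0
    show ?case by (simp add: linear_map_def)
  next
    case (Suc k)
    show ?case using linear_map_comp[OF Suc A] by (simp add: comp_def)
  qed
  have pow_sym: "ip ((A ^^ k) x) y = ip x ((A ^^ k) y)" if "x \<in> S" "y \<in> S" for k x y
    using that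
  proof (induction k arbitrary: y)
    case (Suc k)
    then show ?case using AT[of "(A ^^ k) x" y] AT'[of "(A ^^ k) x" y]
      by (simp add: funpow_swap1)
  qed simp
  \<comment> \<open>A factor of the power of \<open>A\<close>: \<open>W_ip\<close> says that (W j)^*
    (W j) = A^j. Raising \<open>j\<close> by one alternately applies \<open>T\<close> and replaces
    that \<open>T\<close> by \<open>A\<close>, so \<open>contr\<close> and \<open>A_le_T\<close>
    together make the norms decrease.\<close>
  define W where "W j x = (if odd j then T else id) ((A ^^ (j div 2)) x)" for j x
  have WS [simp]: "W j x \<in> S" if "x \<in> S" for j x using that by (simp add: W_def)
  have W_lin: "linear_map S S (W j)" for j
    using linear_map_comp[OF pow_lin T] pow_lin unfolding W_def by simp
  have W_ip: "ip (W j x) (W j y) = ip ((A ^^ j) x) y" if "x \<in> S" "y \<in> S" for j x y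
  proof (cases "even j")
    case True
    then obtain k where "j = k + k" by (metis evenE mult_2)
    then show ?thesis using that pow_sym[of "(A ^^ k) x" y k] by (simp add: W_def funpow_add)
  next
    case False
    then obtain k where "j = Suc (k + k)" by (metis oddE mult_2 Suc_eq_plus1)
    then show ?thesis
      using that pow_sym[of "A ((A ^^ k) x)" y k] AT[of "(A ^^ k) x" "(A ^^ k) y"]
      by (simp add: W_def funpow_add funpow_swap1)
  qed
  \<comment> \<open>This is contractivity of T^* at \<open>T x\<close>, read off from Cauchy-Schwarz
    for |A x|^2 = <T x, T A x>.\<close>
  have A_le_T: "nrm (A x) \<le> nrm (T x)" if x: "x \<in> S" for x
  proof (cases "nrm (A x) = 0")
    case False
    have "(nrm (A x))\<^sup>2 = Re (ip (T x) (T (A x)))" using x by (simp add: nrm_sq AT)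
    also have "\<dots> \<le> nrm (T x) * nrm (T (A x))" using x by (intro Re_ip_le) auto
    also have "\<dots> \<le> nrm (T x) * nrm (A x)" using x contr[of "A x"] by (intro mult_left_mono) auto
    finally have "nrm (A x) * nrm (A x) \<le> nrm (T x) * nrm (A x)" by (simp add: power2_eq_square)
    moreover have "0 < nrm (A x)" using False x by (simp add: less_le)
    ultimately show ?thesis by (simp only: mult_le_cancel_right_pos)
  qed (use x in simp)
  have W_decr: "nrm (W (Suc j) x) \<le> nrm (W j x)" if x: "x \<in> S" for j x
  proof (cases "even j")
    case True
    then show ?thesis using x contr[of "(A ^^ (j div 2)) x"] by (simp add: W_def)
  next
    case False
    then show ?thesis using x A_le_T[of "(A ^^ (j div 2)) x"] by (simp add: W_def)
  qed
  define B where "B j h = W j (h - A h)" for j h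
  have idA: "linear_map S S (\<lambda>h. h - A h)"
    using A by (intro linear_mapI)
      (simp_all add: linear_map_add linear_map_scale scaleC_right_diff_distrib)
  have B_lin: "linear_map S S (B j)" for j
    using linear_map_comp[OF idA W_lin] unfolding B_def .
  have B_sums: "(\<lambda>j. (nrm (B j h))\<^sup>2) sums ((nrm h)\<^sup>2 - (nrm (T h))\<^sup>2)" if h: "h \<in> S" for h
  proof -
    \<comment> \<open>The limit \<open>R\<close> may be nonzero, for instance if \<open>A\<close>
      fixes \<open>h\<close>, but the first differences \<open>b\<close> tend to 0 in any case. The
      squared norms of \<open>B j h\<close> are the second differences of \<open>r\<close>, so their
      sum telescopes to \<open>b 0\<close>.\<close>
    define r where "r j = (nrm (W j h))\<^sup>2" for j
    have r_eq: "r j = Re (ip ((A ^^ j) h) h)" for j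
      using h by (simp add: r_def nrm_sq W_ip)
    have "decseq r"
      unfolding r_def decseq_Suc_iff using W_decr[OF h] h by (auto intro: power_mono)
    then obtain R where R: "r \<longlonglongrightarrow> R"
      using decseq_convergent[of r 0] by (auto simp: r_def)
    define b where "b j = r j - r (Suc j)" for j
    have "b \<longlonglongrightarrow> R - R"
      unfolding b_def using R LIMSEQ_Suc[OF R] by (intro tendsto_intros)
    then have "(\<lambda>j. b j - b (Suc j)) sums (b 0 - 0)"
      using telescope_sums'[of b 0] by simp
    moreover have "b j - b (Suc j) = (nrm (B j h))\<^sup>2" for j
    proof -
      have e: "(A ^^ j) (h - A h) = (A ^^ j) h - (A ^^ Suc j) h"
        using linear_map_add[OF pow_lin, of "h - A h" "A h" j] h
        by (simp add: funpow_Suc_right del: funpow.simps)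
      have sw: "ip ((A ^^ k) h) (A h) = ip ((A ^^ Suc k) h) h" for k
        using h AT'[of "(A ^^ k) h" h] AT[of "(A ^^ k) h" h] by simp
      have "(nrm (B j h))\<^sup>2 = Re (ip ((A ^^ j) (h - A h)) (h - A h))"
        using h by (simp add: B_def nrm_sq W_ip)
      also have "\<dots> = r j - 2 * r (Suc j) + r (Suc (Suc j))"
        unfolding e r_eq using h sw[of j] sw[of "Suc j"]
        by (simp add: ip_diff_left ip_diff_right)
      finally show ?thesis by (simp add: b_def)
    qed
    moreover have "b 0 = (nrm h)\<^sup>2 - (nrm (T h))\<^sup>2" by (simp add: b_def r_def W_def)
    ultimately show ?thesis by simp
  qed
  show ?thesis using that B_lin B_sums by blast
qed

end

section \<open>Square-summable families\<close>

context hilbert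
begin

definition l2 :: "('i \<Rightarrow> 'v) set"
  where "l2 = {x. (\<forall>i. x i \<in> S) \<and> (\<lambda>i. (nrm (x i))\<^sup>2) summable_on UNIV}"

definition l2_ip :: "('i \<Rightarrow> 'v) \<Rightarrow> ('i \<Rightarrow> 'v) \<Rightarrow> complex"
  where "l2_ip x y = (\<Sum>\<^sub>\<infinity>i. ip (x i) (y i))"

lemma l2I:
  assumes "\<And>i. x i \<in> S" "(\<lambda>i. (nrm (x i))\<^sup>2) summable_on UNIV"
  shows "x \<in> l2"
  using assms by (simp add: l2_def)

lemma l2_coord: "x \<in> l2 \<Longrightarrow> x i \<in> S"
  by (simp add: l2_def)

lemma l2_summable: "x \<in> l2 \<Longrightarrow> (\<lambda>i. (nrm (x i))\<^sup>2) summable_on UNIV"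
  by (simp add: l2_def)

lemma l2_comparison:
  assumes "\<And>i. x i \<in> S" "y \<in> l2" "\<And>i. nrm (x i) \<le> nrm (y i)"
  shows "x \<in> l2"
proof (rule l2I)
  show "(\<lambda>i. (nrm (x i))\<^sup>2) summable_on UNIV"
    by (rule summable_on_comparison_test[OF l2_summable[OF assms(2)]])
      (use assms in \<open>auto intro: power_mono\<close>)
qed (fact assms(1))

lemma nrm_add_sq_le:
  assumes "x \<in> S" "y \<in> S"
  shows "(nrm (x + y))\<^sup>2 \<le> 2 * (nrm x)\<^sup>2 + 2 * (nrm y)\<^sup>2"
  using parallelogram[OF assms] zero_le_power2[of "nrm (x - y)"] by linarith

lemma l2_add: "x \<in> l2 \<Longrightarrow> y \<in> l2 \<Longrightarrow> x + y \<in> l2"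
proof (rule l2I)
  assume xy: "x \<in> l2" "y \<in> l2"
  show "(\<lambda>i. (nrm ((x + y) i))\<^sup>2) summable_on UNIV"
  proof (rule summable_on_comparison_test)
    show "(\<lambda>i. 2 * (nrm (x i))\<^sup>2 + 2 * (nrm (y i))\<^sup>2) summable_on UNIV"
      using xy by (intro summable_on_add summable_on_cmult_right l2_summable)
  qed (use xy in \<open>auto intro: nrm_add_sq_le l2_coord\<close>)
qed (auto simp: l2_coord)

lemma l2_scale: "x \<in> l2 \<Longrightarrow> a *\<^sub>C x \<in> l2"
proof (rule l2I)
  assume x: "x \<in> l2"
  then show "(\<lambda>i. (nrm ((a *\<^sub>C x) i))\<^sup>2) summable_on UNIV"
    by (simp add: l2_coord[OF x] nrm_scale power_mult_distrib summable_on_cmult_right l2_summable)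
qed (auto simp: l2_coord)

lemma l2_zero: "0 \<in> l2"
  by (rule l2I) auto

lemma l2_ip_abs_summable:
  assumes "x \<in> l2" "y \<in> l2"
  shows "(\<lambda>i. cmod (ip (x i) (y i))) summable_on UNIV"
proof (rule summable_on_comparison_test)
  show "(\<lambda>i. (nrm (x i))\<^sup>2 + (nrm (y i))\<^sup>2) summable_on UNIV"
    using assms by (intro summable_on_add l2_summable)
  show "cmod (ip (x i) (y i)) \<le> (nrm (x i))\<^sup>2 + (nrm (y i))\<^sup>2" for i
  proof -
    have "2 * (nrm (x i) * nrm (y i)) \<le> (nrm (x i))\<^sup>2 + (nrm (y i))\<^sup>2"
      using sum_squares_bound[of "nrm (x i)" "nrm (y i)"] by simp
    moreover have "0 \<le> nrm (x i) * nrm (y i)" using assms[THEN l2_coord] by simp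
    moreover have "cmod (ip (x i) (y i)) \<le> nrm (x i) * nrm (y i)"
      using assms by (intro Cauchy_Schwarz l2_coord)
    ultimately show ?thesis by linarith
  qed
qed auto

lemma l2_ip_summable: "x \<in> l2 \<Longrightarrow> y \<in> l2 \<Longrightarrow> (\<lambda>i. ip (x i) (y i)) summable_on UNIV"
  by (rule abs_summable_summable[OF l2_ip_abs_summable])

lemma l2_ip_self:
  assumes x: "x \<in> l2"
  shows "l2_ip x x = of_real (\<Sum>\<^sub>\<infinity>i. (nrm (x i))\<^sup>2)"
proof -
  have "((\<lambda>i. complex_of_real ((nrm (x i))\<^sup>2)) has_sum of_real (\<Sum>\<^sub>\<infinity>i. (nrm (x i))\<^sup>2)) UNIV"
    by (intro has_sum_of_real has_sum_infsum l2_summable x)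
  then show ?thesis unfolding l2_ip_def
    by (intro infsumI) (simp only: ip_self l2_coord[OF x])
qed

lemma l2_finite_sum_le:
  assumes "x \<in> l2" "finite F"
  shows "(\<Sum>i\<in>F. (nrm (x i))\<^sup>2) \<le> Re (l2_ip x x)"
  using assms by (simp add: l2_ip_self finite_sum_le_infsum l2_summable)

lemma l2_bounded:
  assumes S: "\<And>i. x i \<in> S" and b: "\<And>F. finite F \<Longrightarrow> (\<Sum>i\<in>F. (nrm (x i))\<^sup>2) \<le> b"
  shows "x \<in> l2" "Re (l2_ip x x) \<le> b"
proof -
  have s: "(\<lambda>i. (nrm (x i))\<^sup>2) summable_on UNIV"
    by (rule nonneg_bounded_partial_sums_imp_summable_on[of _ _ b]) (auto simp: b)
  then show x: "x \<in> l2" using S by (intro l2I)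
  show "Re (l2_ip x x) \<le> b"
    unfolding l2_ip_self[OF x] using infsum_le_finite_sums[OF s] b by simp
qed

text \<open>Each coordinate is dominated by the norm, so coordinatewise limits exist. Bounds on
  finite partial sums survive the limit, and by \<open>l2_bounded\<close> a bound common to all
  finite sets gives membership and the norm estimate together.\<close>

lemma l2_complete:
  assumes mem: "\<And>n::nat. \<sigma> n \<in> l2"
    and Cauchy: "\<And>e. 0 < e \<Longrightarrow>
      \<exists>M. \<forall>m\<ge>M. \<forall>n\<ge>M. sqrt (Re (l2_ip (\<sigma> m - \<sigma> n) (\<sigma> m - \<sigma> n))) < e"
  shows "\<exists>l\<in>l2. (\<lambda>n. sqrt (Re (l2_ip (\<sigma> n - l) (\<sigma> n - l)))) \<longlonglongrightarrow> 0"
proof -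
  \<comment> \<open>\<open>hilbert_l2\<close> rests on this lemma, so closure under subtraction has
    to be derived by hand.\<close>
  have l2_diff: "x - y \<in> l2" if "x \<in> l2" "y \<in> l2" for x y :: "'a \<Rightarrow> 'v"
  proof -
    have "x - y = x + (- 1) *\<^sub>C y" by (auto simp: fun_eq_iff scaleC_minus_left)
    then show ?thesis using that by (metis l2_add l2_scale)
  qed
  define N where "N x = sqrt (Re (l2_ip x x))" for x :: "'a \<Rightarrow> 'v"
  have coord_le: "nrm (x i) \<le> N x" if "x \<in> l2" for x i
    using l2_finite_sum_le[OF that, of "{i}"] unfolding N_def by (intro real_le_rsqrt) simp
  have "\<exists>y\<in>S. (\<lambda>n. nrm (\<sigma> n i - y)) \<longlonglongrightarrow> 0" for i
  proof -
    have "\<exists>M. \<forall>m\<ge>M. \<forall>n\<ge>M. nrm (\<sigma> m i - \<sigma> n i) < e" if "0 < e" for e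
    proof -
      obtain M where M: "\<And>m n. m \<ge> M \<Longrightarrow> n \<ge> M \<Longrightarrow> N (\<sigma> m - \<sigma> n) < e"
        using Cauchy[OF \<open>0 < e\<close>] unfolding N_def by blast
      have "nrm (\<sigma> m i - \<sigma> n i) < e" if "m \<ge> M" "n \<ge> M" for m n
        using coord_le[OF l2_diff[OF mem[of m] mem[of n]], of i] M[OF that] by simp
      then show ?thesis by blast
    qed
    then show ?thesis
      using Cauchy_convergent_nrm[of "\<lambda>n. \<sigma> n i"] l2_coord[OF mem] by metis
  qed
  then obtain l where lS: "\<And>i. l i \<in> S" and l: "\<And>i. (\<lambda>n. nrm (\<sigma> n i - l i)) \<longlonglongrightarrow> 0"
    by metis
  have tail: "\<sigma> m - l \<in> l2 \<and> Re (l2_ip (\<sigma> m - l) (\<sigma> m - l)) \<le> e\<^sup>2"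
    if e: "0 < e" and M: "\<And>n. n \<ge> M \<Longrightarrow> N (\<sigma> m - \<sigma> n) < e" for e m M
  proof -
    have bound: "(\<Sum>i\<in>F. (nrm ((\<sigma> m - l) i))\<^sup>2) \<le> e\<^sup>2" if F: "finite F" for F
    proof (rule LIMSEQ_le_const2)
      have "(\<lambda>n. nrm (\<sigma> m i - \<sigma> n i)) \<longlonglongrightarrow> nrm (\<sigma> m i - l i)" for i
      proof (rule nrm_tendsto)
        have "nrm (\<sigma> m i - \<sigma> n i - (\<sigma> m i - l i)) = nrm (\<sigma> n i - l i)" for n
          using nrm_minus_commute[of "l i" "\<sigma> n i"] lS l2_coord[OF mem] by simp
        then show "(\<lambda>n. nrm (\<sigma> m i - \<sigma> n i - (\<sigma> m i - l i))) \<longlonglongrightarrow> 0" using l[of i] by simp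
      qed (use l2_coord[OF mem] lS in auto)
      then show "(\<lambda>n. \<Sum>i\<in>F. (nrm (\<sigma> m i - \<sigma> n i))\<^sup>2) \<longlonglongrightarrow> (\<Sum>i\<in>F. (nrm ((\<sigma> m - l) i))\<^sup>2)"
        by (auto intro!: tendsto_intros)
      have "(\<Sum>i\<in>F. (nrm (\<sigma> m i - \<sigma> n i))\<^sup>2) \<le> e\<^sup>2" if n: "n \<ge> M" for n
      proof -
        have d: "\<sigma> m - \<sigma> n \<in> l2" using l2_diff mem by blast
        have nn: "0 \<le> Re (l2_ip (\<sigma> m - \<sigma> n) (\<sigma> m - \<sigma> n))"
          using l2_finite_sum_le[OF d, of "{}"] by simp
        have "(\<Sum>i\<in>F. (nrm (\<sigma> m i - \<sigma> n i))\<^sup>2) \<le> (N (\<sigma> m - \<sigma> n))\<^sup>2"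
          using l2_finite_sum_le[OF d F] nn by (simp add: N_def)
        also have "\<dots> \<le> e\<^sup>2" using M[OF n] nn by (intro power_mono) (auto simp: N_def)
        finally show ?thesis .
      qed
      then show "\<exists>M. \<forall>n\<ge>M. (\<Sum>i\<in>F. (nrm (\<sigma> m i - \<sigma> n i))\<^sup>2) \<le> e\<^sup>2" by blast
    qed
    have "(\<sigma> m - l) i \<in> S" for i using l2_coord[OF mem] lS by simp
    from l2_bounded[OF this bound] show ?thesis by blast
  qed
  obtain M1 where M1: "\<And>m n. m \<ge> M1 \<Longrightarrow> n \<ge> M1 \<Longrightarrow> N (\<sigma> m - \<sigma> n) < 1"
    using Cauchy[of 1] unfolding N_def by auto
  have "\<sigma> M1 - l \<in> l2" using tail[of 1 M1 M1] M1 by auto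
  then have "\<sigma> M1 - (\<sigma> M1 - l) \<in> l2" using l2_diff mem by blast
  then have ll: "l \<in> l2" by simp
  have "(\<lambda>n. N (\<sigma> n - l)) \<longlonglongrightarrow> 0"
  proof (rule LIMSEQ_I)
    fix e :: real assume e: "0 < e"
    then obtain M where M: "\<And>m n. m \<ge> M \<Longrightarrow> n \<ge> M \<Longrightarrow> N (\<sigma> m - \<sigma> n) < e / 2"
      using Cauchy[of "e / 2"] unfolding N_def by auto
    have "norm (N (\<sigma> m - l) - 0) < e" if m: "m \<ge> M" for m
    proof -
      have t: "\<sigma> m - l \<in> l2 \<and> Re (l2_ip (\<sigma> m - l) (\<sigma> m - l)) \<le> (e/2)\<^sup>2"
        using tail[of "e / 2" M m] M[OF m] e by auto
      then have "0 \<le> N (\<sigma> m - l)"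
        using l2_finite_sum_le[of "\<sigma> m - l" "{}"] by (simp add: N_def)
      moreover have "N (\<sigma> m - l) \<le> e / 2" using t e unfolding N_def by (intro real_le_lsqrt) auto
      ultimately show ?thesis using e by simp
    qed
    then show "\<exists>M. \<forall>n\<ge>M. norm (N (\<sigma> n - l) - 0) < e" by blast
  qed
  then show ?thesis using ll unfolding N_def by blast
qed

theorem hilbert_l2: "hilbert l2 l2_ip"
proof
  fix x y z :: "'i \<Rightarrow> 'v" and a
  assume x: "x \<in> l2"
  show "0 \<le> Re (l2_ip x x)" using l2_finite_sum_le[OF x, of "{}"] by simp
  show "x = 0" if "l2_ip x x = 0"
  proof
    fix i
    show "x i = 0 i"
      using l2_finite_sum_le[OF x, of "{i}"] that nrm_eq_0[OF l2_coord[OF x]] by simp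
  qed
  assume y: "y \<in> l2"
  show "l2_ip (a *\<^sub>C x) y = a * l2_ip x y"
    unfolding l2_ip_def infsum_cmult_right'[symmetric]
    by (intro infsum_cong) (simp add: ip_linear l2_coord[OF x] l2_coord[OF y])
  show "l2_ip y x = cnj (l2_ip x y)"
    unfolding l2_ip_def infsum_cnj[symmetric]
    by (intro infsum_cong) (simp add: ip_cnj[symmetric] l2_coord[OF x] l2_coord[OF y])
  assume z: "z \<in> l2"
  have "l2_ip (x + y) z = (\<Sum>\<^sub>\<infinity>i. ip (x i) (z i) + ip (y i) (z i))"
    unfolding l2_ip_def
    by (intro infsum_cong) (simp add: ip_linear l2_coord[OF x] l2_coord[OF y] l2_coord[OF z])
  also have "\<dots> = l2_ip x z + l2_ip y z"
    unfolding l2_ip_def using x y z by (intro infsum_add l2_ip_summable)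
  finally show "l2_ip (x + y) z = l2_ip x z + l2_ip y z" .
qed (use l2_zero l2_add l2_scale l2_complete in blast)+

end

section \<open>The twisted Ando construction\<close>

context hilbert
begin

text \<open>\<open>R\<close> is 2 p - 1 with \<open>p\<close> the orthogonal projection onto
  \<open>L\<close>. Its action on an orthogonal decomposition, the last conclusion, already yields
  involutivity, isometry and linearity.\<close>

lemma reflection:
  assumes L: "closed_subspace L"
  obtains R where "linear_map S S R" "\<And>x. x \<in> S \<Longrightarrow> R (R x) = x" "\<And>x. x \<in> S \<Longrightarrow> nrm (R x) = nrm x"
    "\<And>x. x \<in> S \<Longrightarrow> \<exists>a b. x = a + b \<and> a \<in> L \<and> b \<in> S \<and> (\<forall>l\<in>L. ip b l = 0)"
    "\<And>a b. a \<in> L \<Longrightarrow> b \<in> S \<Longrightarrow> (\<And>l. l \<in> L \<Longrightarrow> ip b l = 0) \<Longrightarrow> R (a + b) = a - b"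
proof -
  have LS: "\<And>l. l \<in> L \<Longrightarrow> l \<in> S"
    and Ladd: "\<And>l m. l \<in> L \<Longrightarrow> m \<in> L \<Longrightarrow> l + m \<in> L" and Lsc: "\<And>a l. l \<in> L \<Longrightarrow> a *\<^sub>C l \<in> L"
    using L by (simp_all add: closed_subspace_def subset_eq)
  have Ldiff: "l - m \<in> L" if "l \<in> L" "m \<in> L" for l m
    using Ladd[OF that(1) Lsc[OF that(2), of "- 1"]] by (simp add: scaleC_minus_left)
  have "\<exists>p. p \<in> L \<and> (\<forall>l\<in>L. ip (x - p) l = 0)" if "x \<in> S" for x
    by (rule projection_exists[OF L that]) blast
  then obtain p where p': "\<And>x. x \<in> S \<Longrightarrow> p x \<in> L \<and> (\<forall>l\<in>L. ip (x - p x) l = 0)"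
    using bchoice[of S "\<lambda>x p. p \<in> L \<and> (\<forall>l\<in>L. ip (x - p) l = 0)"] by blast
  have pL: "\<And>x. x \<in> S \<Longrightarrow> p x \<in> L"
    and p: "\<And>x l. x \<in> S \<Longrightarrow> l \<in> L \<Longrightarrow> ip (x - p x) l = 0"
    using p' by blast+
  have pS: "p x \<in> S" if "x \<in> S" for x using pL LS that by blast
  define R where "R x = p x - (x - p x)" for x
  have RS: "R x \<in> S" if "x \<in> S" for x using that pS by (simp add: R_def)
  have dec: "\<exists>a b. x = a + b \<and> a \<in> L \<and> b \<in> S \<and> (\<forall>l\<in>L. ip b l = 0)" if x: "x \<in> S" for x
    using x pL p pS by (intro exI[of _ "p x"] exI[of _ "x - p x"]) auto
  have R: "R (a + b) = a - b" if a: "a \<in> L" and b: "b \<in> S" and bL: "\<And>l. l \<in> L \<Longrightarrow> ip b l = 0" for a b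
  proof -
    have ab: "a \<in> S" "a + b \<in> S" using a b LS by auto
    \<comment> \<open>This vector lies in \<open>L\<close> and is a difference of two vectors
      orthogonal to \<open>L\<close>, hence orthogonal to itself.\<close>
    define l where "l = a - p (a + b)"
    have l: "l \<in> L" "l \<in> S" using a pL[OF ab(2)] Ldiff LS by (auto simp: l_def)
    have "ip l l = ip (a + b - p (a + b)) l - ip b l"
      using ab b pS[OF ab(2)] l(2) by (simp add: l_def ip_linear)
    also have "\<dots> = 0" using p[OF ab(2) l(1)] bL[OF l(1)] by simp
    finally have "p (a + b) = a" using ip_definite[OF l(2)] by (simp add: l_def)
    then show ?thesis by (simp add: R_def)
  qed
  have inv: "R (R x) = x" if x: "x \<in> S" for x
  proof -
    obtain a b where ab: "x = a + b" "a \<in> L" "b \<in> S" "\<forall>l\<in>L. ip b l = 0" using dec[OF x] by blast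
    have "R (a + - b) = a - - b" using ab LS by (intro R) (auto simp: ip_linear)
    then show ?thesis using ab R[of a b] by simp
  qed
  have iso: "nrm (R x) = nrm x" if x: "x \<in> S" for x
  proof -
    obtain a b where ab: "x = a + b" "a \<in> L" "b \<in> S" "\<forall>l\<in>L. ip b l = 0" using dec[OF x] by blast
    have "ip a b = 0" using ab LS ip_cnj[of b a] by simp
    then have "(nrm (a - b))\<^sup>2 = (nrm (a + b))\<^sup>2"
      using ab LS by (simp add: nrm_add_sq nrm_diff_sq)
    then show ?thesis using ab R[of a b] LS by (simp add: power2_eq_iff_nonneg)
  qed
  have "linear_map S S R"
  proof (rule linear_mapI)
    fix x y assume x: "x \<in> S" and y: "y \<in> S"
    obtain a b where ab: "x = a + b" "a \<in> L" "b \<in> S" "\<forall>l\<in>L. ip b l = 0" using dec[OF x] by blast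
    obtain c d where cd: "y = c + d" "c \<in> L" "d \<in> S" "\<forall>l\<in>L. ip d l = 0" using dec[OF y] by blast
    have "R ((a + c) + (b + d)) = (a + c) - (b + d)"
      using ab cd LS Ladd by (intro R) (auto simp: ip_linear)
    moreover have "x + y = (a + c) + (b + d)" using ab cd by simp
    moreover have "R x = a - b" "R y = c - d" using ab cd R by auto
    ultimately show "R (x + y) = R x + R y" by simp
  next
    fix x t assume x: "x \<in> S"
    obtain a b where ab: "x = a + b" "a \<in> L" "b \<in> S" "\<forall>l\<in>L. ip b l = 0" using dec[OF x] by blast
    have "R (t *\<^sub>C a + t *\<^sub>C b) = t *\<^sub>C a - t *\<^sub>C b"
      using ab LS Lsc by (intro R) (auto simp: ip_linear)
    moreover have "R x = a - b" using ab R by auto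
    ultimately show "R (t *\<^sub>C x) = t *\<^sub>C R x"
      using ab(1) by (simp add: scaleC_right_distrib scaleC_right_diff_distrib)
  qed (rule RS)
  then show ?thesis using that inv iso dec R by blast
qed

lemma closed_subspace_orthogonal:
  assumes "E \<subseteq> S"
  shows "closed_subspace {x \<in> S. \<forall>e\<in>E. ip x e = 0}" (is "closed_subspace ?L")
  unfolding closed_subspace_def
proof (intro conjI ballI allI impI)
  fix \<sigma> l assume \<sigma>: "\<forall>n::nat. \<sigma> n \<in> ?L" and l: "l \<in> S" "(\<lambda>n. nrm (\<sigma> n - l)) \<longlonglongrightarrow> 0"
  have "ip l e = 0" if e: "e \<in> E" for e
  proof -
    have "e \<in> S" using e assms by blast
    then have "(\<lambda>n. ip (\<sigma> n) e) \<longlonglongrightarrow> ip l e"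
      using \<sigma> l by (intro ip_tendsto) auto
    moreover have "ip (\<sigma> n) e = 0" for n using \<sigma> e by blast
    ultimately show ?thesis by (simp add: LIMSEQ_const_iff)
  qed
  then show "l \<in> ?L" using l by blast
qed (use assms in \<open>auto simp: ip_linear subset_eq\<close>)

end

section \<open>The abstract dilation argument\<close>

text \<open>
  Here \<open>K\<close> is the sum of \<open>J S\<close> and of levels on which \<open>Sh\<close> is the shift; \<open>P\<close> and \<open>Sb\<close> are the
  adjoints of \<open>J\<close> and \<open>Sh\<close>, and the unitary \<open>Q\<close> with inverse \<open>Q'\<close> multiplies level \<open>l\<close> by
  \<open>q ^ (l div 2)\<close>.
\<close>

locale dilation_data = H: hilbert S ip + K: hilbert K kip
  for S :: "'v::complex_vector set" and ip and K :: "'w::complex_vector set" and kip +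
  fixes T1 T2 :: "'v \<Rightarrow> 'v" and q :: complex
    and J D1 D2 :: "'v \<Rightarrow> 'w" and P :: "'w \<Rightarrow> 'v" and Sh Sb Q Q' :: "'w \<Rightarrow> 'w"
  assumes T1: "linear_map S S T1" and T2: "linear_map S S T2"
    and q: "cmod q = 1" and T12: "h \<in> S \<Longrightarrow> T1 (T2 h) = q *\<^sub>C T2 (T1 h)"
    and J: "linear_map S K J" and D1: "linear_map S K D1" and D2: "linear_map S K D2"
    and P: "linear_map K S P" and Sh: "linear_map K K Sh" and Sb: "linear_map K K Sb"
    and Q: "linear_map K K Q" and Q': "linear_map K K Q'"
    and J_adj: "h \<in> S \<Longrightarrow> x \<in> K \<Longrightarrow> kip (J h) x = ip h (P x)"
    and PJ [simp]: "h \<in> S \<Longrightarrow> P (J h) = h"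
    and PSh [simp]: "x \<in> K \<Longrightarrow> P (Sh x) = 0"
    and Sh_adj: "x \<in> K \<Longrightarrow> y \<in> K \<Longrightarrow> kip (Sh x) y = kip x (Sb y)"
    and SbSh: "x \<in> K \<Longrightarrow> Sb (Sh x) = x - J (P x)"
    and PD [simp]: "h \<in> S \<Longrightarrow> P (D1 h) = 0" "h \<in> S \<Longrightarrow> P (D2 h) = 0"
    and SbD [simp]: "h \<in> S \<Longrightarrow> Sb (D1 h) = 0" "h \<in> S \<Longrightarrow> Sb (D2 h) = 0"
    and D1_nrm: "h \<in> S \<Longrightarrow> (K.nrm (D1 h))\<^sup>2 = (H.nrm h)\<^sup>2 - (H.nrm (T1 h))\<^sup>2"
    and D2_nrm: "h \<in> S \<Longrightarrow> (K.nrm (D2 h))\<^sup>2 = (H.nrm h)\<^sup>2 - (H.nrm (T2 h))\<^sup>2"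
    and D12: "h \<in> S \<Longrightarrow> h' \<in> S \<Longrightarrow> kip (D1 h) (D2 h') = 0"
    and Q'Q: "x \<in> K \<Longrightarrow> Q' (Q x) = x" and QQ': "x \<in> K \<Longrightarrow> Q (Q' x) = x"
    and Q_nrm: "x \<in> K \<Longrightarrow> K.nrm (Q x) = K.nrm x"
    and PQ: "x \<in> K \<Longrightarrow> P (Q x) = P x"
    and QJ: "h \<in> S \<Longrightarrow> Q (J h) = J h"
    and QD1: "h \<in> S \<Longrightarrow> Q (D1 h) = D1 h" "h \<in> S \<Longrightarrow> Q (Sh (D1 h)) = Sh (D1 h)"
    and QD2: "h \<in> S \<Longrightarrow> Q (D2 h) = D2 h" "h \<in> S \<Longrightarrow> Q (Sh (D2 h)) = Sh (D2 h)"
    and QSh: "x \<in> K \<Longrightarrow> Q (Sh (Sh x)) = q *\<^sub>C Sh (Sh (Q x))"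
begin

lemmas linear_maps = T1 T2 J D1 D2 P Sh Sb Q Q'

lemma mem [simp]:
  "h \<in> S \<Longrightarrow> T1 h \<in> S" "h \<in> S \<Longrightarrow> T2 h \<in> S"
  "h \<in> S \<Longrightarrow> J h \<in> K" "h \<in> S \<Longrightarrow> D1 h \<in> K" "h \<in> S \<Longrightarrow> D2 h \<in> K" "x \<in> K \<Longrightarrow> P x \<in> S"
  "x \<in> K \<Longrightarrow> Sh x \<in> K" "x \<in> K \<Longrightarrow> Sb x \<in> K" "x \<in> K \<Longrightarrow> Q x \<in> K" "x \<in> K \<Longrightarrow> Q' x \<in> K"
  using linear_maps by (auto intro: linear_map_mem)

lemmas lin_add = linear_maps[THEN linear_map_add]
lemmas lin_scale = linear_maps[THEN linear_map_scale]

lemma P_diff: "x \<in> K \<Longrightarrow> y \<in> K \<Longrightarrow> P (x - y) = P x - P y"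
  using lin_add(6)[of "x - y" y] by simp

lemma Sb_diff: "x \<in> K \<Longrightarrow> y \<in> K \<Longrightarrow> Sb (x - y) = Sb x - Sb y"
  using lin_add(8)[of "x - y" y] by simp

lemma Sh_diff: "x \<in> K \<Longrightarrow> y \<in> K \<Longrightarrow> Sh (x - y) = Sh x - Sh y"
  using lin_add(7)[of "x - y" y] by simp

lemma J_zero [simp]: "J 0 = 0"
  using lin_scale(3)[of 0 0] by simp

lemma J_adj': "h \<in> S \<Longrightarrow> x \<in> K \<Longrightarrow> kip x (J h) = ip (P x) h"
  using K.ip_cnj[of "J h" x] H.ip_cnj[of h "P x"] by (simp add: J_adj)

lemma Sh_adj': "x \<in> K \<Longrightarrow> y \<in> K \<Longrightarrow> kip y (Sh x) = kip (Sb y) x"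
  using K.ip_cnj[of "Sh x" y] K.ip_cnj[of x "Sb y"] by (simp add: Sh_adj)

text \<open>By \<open>SbSh\<close>, \<open>Sh\<close> is a partial isometry whose kernel is the
  range of \<open>J\<close>.\<close>

lemma Sh_nrm: "x \<in> K \<Longrightarrow> (K.nrm (Sh x))\<^sup>2 = (K.nrm x)\<^sup>2 - (H.nrm (P x))\<^sup>2"
  by (simp add: K.nrm_sq H.nrm_sq Sh_adj SbSh K.ip_linear J_adj')

lemma J_nrm: "h \<in> S \<Longrightarrow> (K.nrm (J h))\<^sup>2 = (H.nrm h)\<^sup>2"
  by (simp add: K.nrm_sq H.nrm_sq J_adj)

lemma ShJ [simp]: "h \<in> S \<Longrightarrow> Sh (J h) = 0"
  using Sh_nrm[of "J h"] K.nrm_eq_0[of "Sh (J h)"] by (simp add: J_nrm)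

lemma SbJ [simp]: "h \<in> S \<Longrightarrow> Sb (J h) = 0"
  using Sh_adj'[of "Sb (J h)" "J h"] K.ip_definite[of "Sb (J h)"] by (simp add: J_adj)

text \<open>The three summands are pairwise orthogonal, and their squared norms telescope: |T P
  x|^2, then |P x|^2 - |T P x|^2, then |x|^2 - |P x|^2.\<close>

lemma nrm_dilation:
  assumes D: "linear_map S K D" and PD: "\<And>h. h \<in> S \<Longrightarrow> P (D h) = 0"
    and SbD: "\<And>h. h \<in> S \<Longrightarrow> Sb (D h) = 0" and T: "linear_map S S T"
    and nrm: "\<And>h. h \<in> S \<Longrightarrow> (K.nrm (D h))\<^sup>2 = (H.nrm h)\<^sup>2 - (H.nrm (T h))\<^sup>2" and x: "x \<in> K"
  shows "K.nrm (J (T (P x)) + D (P x) + Sh x) = K.nrm x"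
proof -
  have m: "P x \<in> S" "T (P x) \<in> S" "D (P x) \<in> K"
    using x linear_map_mem[OF D] linear_map_mem[OF T] by auto
  have "(K.nrm (J (T (P x)) + D (P x) + Sh x))\<^sup>2 = (K.nrm x)\<^sup>2"
    using x m by (simp add: K.nrm_add_sq K.ip_linear J_adj Sh_adj' PD SbD J_nrm nrm Sh_nrm lin_add)
  then show ?thesis using x m by (simp add: power2_eq_iff_nonneg)
qed

lemma linear_dilation:
  assumes D: "linear_map S K D" and T: "linear_map S S T"
  shows "linear_map K K (\<lambda>x. J (T (P x)) + D (P x) + Sh x)"
  using linear_map_mem[OF D] linear_map_mem[OF T]
  by (intro linear_mapI)
    (simp_all add: lin_add lin_scale linear_map_add[OF D] linear_map_add[OF T]
      linear_map_scale[OF D] linear_map_scale[OF T] scaleC_right_distrib)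

text \<open>Polarization: the norm identity at \<open>x + y\<close> gives the real parts, and
  replacing \<open>x\<close> by \<open>\<i> *\<^sub>C x\<close> gives the imaginary parts.\<close>

lemma ip_defect:
  assumes D: "linear_map S K D" and T: "linear_map S S T"
    and nrm: "\<And>h. h \<in> S \<Longrightarrow> (K.nrm (D h))\<^sup>2 = (H.nrm h)\<^sup>2 - (H.nrm (T h))\<^sup>2"
    and x: "x \<in> S" and y: "y \<in> S"
  shows "kip (D x) (D y) = ip x y - ip (T x) (T y)"
proof -
  have m: "D x \<in> K" "T x \<in> S" if "x \<in> S" for x
    using that linear_map_mem[OF D] linear_map_mem[OF T] by auto
  have R: "Re (kip (D x) (D y)) = Re (ip x y) - Re (ip (T x) (T y))" if x: "x \<in> S" for x
    using nrm[of "x + y"] x y m nrm[OF x] nrm[OF y]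
    by (simp add: linear_map_add[OF D] linear_map_add[OF T] K.nrm_add_sq H.nrm_add_sq)
  show ?thesis
    using R[OF x] R[of "\<i> *\<^sub>C x"] x y m
    by (simp add: linear_map_scale[OF D] linear_map_scale[OF T] K.ip_linear H.ip_linear
        complex_eq_iff)
qed

definition V1 where "V1 x = J (T1 (P x)) + D1 (P x) + Sh x"
definition V2 where "V2 x = J (T2 (P x)) + D2 (P x) + Sh x"
text \<open>The part of V_1 V_2 (J h) outside the base space: the second defect, written first, has
  been shifted to level 1, and the first defect of T_2 h sits on level 0. In \<open>d\<close> the
  two operators change places.\<close>

definition c where "c h = D1 (T2 h) + Sh (D2 h)"
definition d where "d h = D2 (T1 h) + Sh (D1 h)"

lemma V1: "linear_map K K V1" and V2: "linear_map K K V2"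
  unfolding V1_def V2_def by (rule linear_dilation[OF D1 T1], rule linear_dilation[OF D2 T2])

lemma V_mem [simp]: "x \<in> K \<Longrightarrow> V1 x \<in> K" "x \<in> K \<Longrightarrow> V2 x \<in> K"
  using V1 V2 linear_map_mem by blast+

lemma V1_nrm: "x \<in> K \<Longrightarrow> K.nrm (V1 x) = K.nrm x"
  unfolding V1_def by (rule nrm_dilation[OF D1 _ _ T1 D1_nrm]) auto

lemma V2_nrm: "x \<in> K \<Longrightarrow> K.nrm (V2 x) = K.nrm x"
  unfolding V2_def by (rule nrm_dilation[OF D2 _ _ T2 D2_nrm]) auto

lemma PV [simp]: "x \<in> K \<Longrightarrow> P (V1 x) = T1 (P x)" "x \<in> K \<Longrightarrow> P (V2 x) = T2 (P x)"
  by (simp_all add: V1_def V2_def lin_add)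

lemma cd_mem [simp]: "h \<in> S \<Longrightarrow> c h \<in> K" "h \<in> S \<Longrightarrow> d h \<in> K"
  by (simp_all add: c_def d_def)

lemma P_cd [simp]: "h \<in> S \<Longrightarrow> P (c h) = 0" "h \<in> S \<Longrightarrow> P (d h) = 0"
  by (simp_all add: c_def d_def lin_add)

lemma SbSb_cd [simp]: "h \<in> S \<Longrightarrow> Sb (Sb (c h)) = 0" "h \<in> S \<Longrightarrow> Sb (Sb (d h)) = 0"
  by (simp_all add: c_def d_def lin_add SbSh)

lemma V1V2: "x \<in> K \<Longrightarrow> V1 (V2 x) = J (T1 (T2 (P x))) + c (P x) + Sh (Sh x)"
  using PV(2)[of x] unfolding V1_def by (simp add: V2_def c_def lin_add)

lemma V2V1: "x \<in> K \<Longrightarrow> V2 (V1 x) = J (T2 (T1 (P x))) + d (P x) + Sh (Sh x)"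
  using PV(1)[of x] unfolding V2_def by (simp add: V1_def d_def lin_add)

lemma D21: "h \<in> S \<Longrightarrow> h' \<in> S \<Longrightarrow> kip (D2 h) (D1 h') = 0"
  using K.ip_cnj[of "D1 h'" "D2 h"] by (simp add: D12)

text \<open>On each of the two levels a value of \<open>D1\<close> meets a value of
  \<open>D2\<close>, so \<open>D12\<close> applies twice.\<close>

lemma kip_cd: "h \<in> S \<Longrightarrow> h' \<in> S \<Longrightarrow> kip (c h) (d h') = 0"
  by (simp add: c_def d_def K.ip_linear Sh_adj Sh_adj' D12 D21 SbSh lin_add)

lemma kip_dc: "h \<in> S \<Longrightarrow> h' \<in> S \<Longrightarrow> kip (d h) (c h') = 0"
  using K.ip_cnj[of "c h'" "d h"] by (simp add: kip_cd)

lemma q_cnj [simp]: "q * cnj q = 1" "cnj q * q = 1"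
  using q complex_norm_square[of q] by (simp_all add: mult.commute)

text \<open>The two defects telescope to <h, h'> - <T_1 T_2 h, T_1 T_2 h'> for \<open>c\<close>, and
  to the same with T_2 T_1 for \<open>d\<close>; q-commutation changes the subtracted term only by
  the factor \<open>q * cnj q\<close>, which is 1.\<close>

lemma kip_cc_dd:
  assumes h: "h \<in> S" "h' \<in> S"
  shows "kip (c h) (c h') = kip (d h) (d h')"
proof -
  note D1p = ip_defect[OF D1 T1 D1_nrm] and D2p = ip_defect[OF D2 T2 D2_nrm]
  have "kip (c h) (c h') = ip h h' - ip (T1 (T2 h)) (T1 (T2 h'))"
    using h by (simp add: c_def K.ip_linear Sh_adj Sh_adj' SbSh D1p D2p lin_add)
  also have "ip (T1 (T2 h)) (T1 (T2 h')) = q * cnj q * ip (T2 (T1 h)) (T2 (T1 h'))"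
    using h by (simp add: T12 H.ip_linear del: q_cnj)
  also have "ip h h' - \<dots> = kip (d h) (d h')"
    using h by (simp add: d_def K.ip_linear Sh_adj Sh_adj' SbSh D1p D2p lin_add)
  finally show ?thesis .
qed

text \<open>
  Reflecting along all even shifts of \<open>c h - q d h\<close> at once makes the reflection commute
  with \<open>Sh\<^sup>2\<close>.
\<close>

definition E where "E i h = ((\<lambda>x. Sh (Sh x)) ^^ i) (c h - q *\<^sub>C d h)"

lemma E_simps [simp]: "E 0 h = c h - q *\<^sub>C d h" "E (Suc i) h = Sh (Sh (E i h))"
  by (simp_all add: E_def)

lemma E_mem [simp]: "h \<in> S \<Longrightarrow> E i h \<in> K"
  by (induction i) simp_all

lemma P_E [simp]: "h \<in> S \<Longrightarrow> P (E i h) = 0"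
  by (cases i) (simp_all add: P_diff lin_scale)

text \<open>The fixed space of the reflection. Taking it as an orthogonal complement makes
  closedness automatic and spares the closed span of the \<open>E i h\<close>.\<close>

definition L where "L = {x \<in> K. \<forall>e \<in> {E i h |i h. h \<in> S}. kip x e = 0}"

lemma L_closed: "K.closed_subspace L"
  unfolding L_def by (rule K.closed_subspace_orthogonal) auto

lemma L_iff: "x \<in> L \<longleftrightarrow> x \<in> K \<and> (\<forall>i. \<forall>h\<in>S. kip x (E i h) = 0)"
  by (auto simp: L_def)

lemma J_mem_L: "h \<in> S \<Longrightarrow> J h \<in> L"
  by (simp add: L_iff J_adj)

text \<open>Adjointness moves the double shift to \<open>E i h\<close>: it kills
  \<open>E 0 h\<close>, which lives on two levels only, and lowers the index otherwise.\<close>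

lemma ShSh_mem_L:
  assumes "a \<in> L"
  shows "Sh (Sh a) \<in> L"
proof -
  have a: "a \<in> K" using assms by (simp add: L_iff)
  have "kip (Sh (Sh a)) (E i h) = 0" if h: "h \<in> S" for i h
  proof (cases i)
    case 0
    then show ?thesis using a h by (simp add: Sh_adj Sb_diff lin_scale)
  next
    case (Suc j)
    then show ?thesis using assms a h by (simp add: Sh_adj SbSh L_iff)
  qed
  then show ?thesis using a by (simp add: L_iff)
qed

text \<open>By adjointness this makes the orthogonal complement of \<open>L\<close> invariant under
  the double shift, as \<open>ShSh_mem_L\<close> does for \<open>L\<close> itself.\<close>

lemma SbSb_mem_L:
  assumes "l \<in> L"
  shows "Sb (Sb l) \<in> L"
proof -
  have l: "l \<in> K" using assms by (simp add: L_iff)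
  have "kip (Sb (Sb l)) (E i h) = 0" if h: "h \<in> S" for i h
  proof -
    have "kip (Sb (Sb l)) (E i h) = kip l (E (Suc i) h)" using l h by (simp add: Sh_adj')
    also have "\<dots> = 0" using assms h unfolding L_iff by blast
    finally show ?thesis .
  qed
  then show ?thesis using l by (simp add: L_iff)
qed

text \<open>This is the \<open>L\<close>-component of \<open>c h\<close>. Against
  \<open>E 0 h'\<close> the mixed terms vanish by \<open>kip_cd\<close> and the rest cancels by
  \<open>kip_cc_dd\<close>; against later \<open>E i h'\<close> only levels beyond the first two
  matter.\<close>

lemma sum_mem_L:
  assumes h: "h \<in> S"
  shows "(1/2) *\<^sub>C (c h + q *\<^sub>C d h) \<in> L"
proof -
  have "kip (c h + q *\<^sub>C d h) (E i h') = 0" if h': "h' \<in> S" for i h'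
  proof (cases i)
    case 0
    have "kip (c h + q *\<^sub>C d h) (E 0 h') = kip (c h) (c h') - (q * cnj q) * kip (d h) (d h')"
      using h h' by (simp add: K.ip_linear kip_cd kip_dc del: q_cnj)
    then show ?thesis using 0 h h' kip_cc_dd by simp
  next
    case (Suc j)
    then show ?thesis
      using h h' by (simp add: Sh_adj' lin_add lin_scale)
  qed
  then show ?thesis using h by (simp add: L_iff K.ip_scale_left)
qed

lemma dilation:
  obtains W1 W2 where "linear_map K K W1" "linear_map K K W2"
    "\<And>x. x \<in> K \<Longrightarrow> K.nrm (W1 x) = K.nrm x" "\<And>x. x \<in> K \<Longrightarrow> K.nrm (W2 x) = K.nrm x"
    "\<And>x. x \<in> K \<Longrightarrow> W1 (W2 x) = q *\<^sub>C W2 (W1 x)"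
    "\<And>x. x \<in> K \<Longrightarrow> P (W1 x) = T1 (P x)" "\<And>x. x \<in> K \<Longrightarrow> P (W2 x) = T2 (P x)"
proof -
  obtain R where R: "linear_map K K R" and RR: "\<And>x. x \<in> K \<Longrightarrow> R (R x) = x"
    and R_nrm: "\<And>x. x \<in> K \<Longrightarrow> K.nrm (R x) = K.nrm x"
    and dec: "\<And>x. x \<in> K \<Longrightarrow> \<exists>a b. x = a + b \<and> a \<in> L \<and> b \<in> K \<and> (\<forall>l\<in>L. kip b l = 0)"
    and R_dec: "\<And>a b. a \<in> L \<Longrightarrow> b \<in> K \<Longrightarrow> (\<And>l. l \<in> L \<Longrightarrow> kip b l = 0) \<Longrightarrow> R (a + b) = a - b"
    using K.reflection[OF L_closed] by blast
  have LK: "l \<in> K" if "l \<in> L" for l using that by (simp add: L_iff)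
  have Rm [simp]: "R x \<in> K" if "x \<in> K" for x using linear_map_mem[OF R that] .
  have RJ: "R (J h) = J h" if "h \<in> S" for h
    using R_dec[of "J h" 0] that J_mem_L LK by simp
  have PR: "P (R x) = P x" if x: "x \<in> K" for x
  proof -
    obtain a b where ab: "x = a + b" "a \<in> L" "b \<in> K" "\<And>l. l \<in> L \<Longrightarrow> kip b l = 0"
      using dec[OF x] by blast
    have aK: "a \<in> K" using LK ab by blast
    \<comment> \<open>\<open>L\<close> contains the range of \<open>J\<close>, so the component that
      \<open>R\<close> negates has no base part.\<close>
    have "ip (P b) (P b) = kip b (J (P b))" using ab by (simp add: J_adj')
    also have "\<dots> = 0" using ab J_mem_L by simp
    finally have "P b = 0" using H.ip_definite ab by simp
    moreover have "R x = a - b" using R_dec ab by simp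
    ultimately show ?thesis using ab aK by (simp add: P_diff lin_add)
  qed
  have Rc: "R (c h) = q *\<^sub>C d h" if h: "h \<in> S" for h
  proof -
    \<comment> \<open>\<open>c h\<close> is \<open>?a + ?b\<close> with \<open>?a\<close> in
      \<open>L\<close> and \<open>?b\<close> half of \<open>E 0 h\<close>; flipping the sign of
      \<open>?b\<close> leaves \<open>q *\<^sub>C d h\<close>.\<close>
    let ?a = "(1/2) *\<^sub>C (c h + q *\<^sub>C d h)" and ?b = "(1/2) *\<^sub>C (c h - q *\<^sub>C d h)"
    have "kip ?b l = 0" if l: "l \<in> L" for l
    proof -
      have "kip l (E 0 h) = 0" using l h unfolding L_iff by blast
      then have "kip (E 0 h) l = 0" using K.ip_cnj[of l "E 0 h"] LK[OF l] h by simp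
      then show ?thesis using LK[OF l] h by (simp add: K.ip_scale_left)
    qed
    then have "R (?a + ?b) = ?a - ?b" using h sum_mem_L by (intro R_dec) auto
    moreover have half: "(1/2) *\<^sub>C x + (1/2) *\<^sub>C x = x" for x :: 'w
      using scaleC_left_distrib[of "1/2" "1/2" x] by simp
    have "?a + ?b = (1/2) *\<^sub>C c h + (1/2) *\<^sub>C c h"
      by (simp add: scaleC_right_distrib scaleC_right_diff_distrib)
    then have "?a + ?b = c h" by (simp only: half)
    moreover have "?a - ?b = (1/2) *\<^sub>C (q *\<^sub>C d h) + (1/2) *\<^sub>C (q *\<^sub>C d h)"
      by (simp add: scaleC_right_distrib scaleC_right_diff_distrib)
    then have "?a - ?b = q *\<^sub>C d h" by (simp only: half)
    ultimately show ?thesis by (simp only:)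
  qed
  have RSh: "R (Sh (Sh x)) = Sh (Sh (R x))" if x: "x \<in> K" for x
  proof -
    obtain a b where ab: "x = a + b" "a \<in> L" "b \<in> K" "\<And>l. l \<in> L \<Longrightarrow> kip b l = 0"
      using dec[OF x] by blast
    have aK: "a \<in> K" using LK ab by blast
    have "R (Sh (Sh a) + Sh (Sh b)) = Sh (Sh a) - Sh (Sh b)"
      \<comment> \<open>The double shift respects the decomposition along \<open>L\<close>: each of
        the two invariance lemmas treats one summand.\<close>
      using ab ShSh_mem_L SbSb_mem_L LK by (intro R_dec) (auto simp: Sh_adj)
    moreover have "R x = a - b" using R_dec ab by simp
    ultimately show ?thesis using ab aK by (simp add: lin_add Sh_diff)
  qed
  \<comment> \<open>The factor \<open>q\<close> has a separate source on each part:
    \<open>T12\<close> on the base space, \<open>Rc\<close> on the first two levels, and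
    \<open>QSh\<close> on all later ones.\<close>
  have key: "Q (R (V1 (V2 x))) = q *\<^sub>C V2 (V1 (Q (R x)))" if x: "x \<in> K" for x
  proof -
    have "R (V1 (V2 x)) = J (T1 (T2 (P x))) + q *\<^sub>C d (P x) + Sh (Sh (R x))"
      using x by (simp add: V1V2 linear_map_add[OF R] RJ Rc RSh)
    then have "Q (R (V1 (V2 x)))
        = J (q *\<^sub>C T2 (T1 (P x))) + q *\<^sub>C d (P x) + q *\<^sub>C Sh (Sh (Q (R x)))"
      using x by (simp add: lin_add lin_scale QJ T12 QSh d_def QD1 QD2)
    also have "\<dots> = q *\<^sub>C V2 (V1 (Q (R x)))"
      using x by (simp add: V2V1 PQ PR lin_scale scaleC_right_distrib)
    finally show ?thesis .
  qed
  \<comment> \<open>With G = \<open>Q\<close> after \<open>R\<close>, the inverse is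
    \<open>R\<close> after \<open>Q'\<close>, since \<open>R\<close> is an involution.\<close>
  define W1 where "W1 x = Q (R (V1 x))" for x
  define W2 where "W2 x = V2 (R (Q' x))" for x
  have PQ': "P (Q' x) = P x" if "x \<in> K" for x using PQ[of "Q' x"] QQ' that by simp
  have Q'_nrm: "K.nrm (Q' x) = K.nrm x" if "x \<in> K" for x using Q_nrm[of "Q' x"] QQ' that by simp
  show ?thesis
  proof (rule that)
    show "linear_map K K W1" unfolding W1_def
      by (rule linear_map_comp[OF linear_map_comp[OF V1 R] Q])
    show "linear_map K K W2" unfolding W2_def
      by (rule linear_map_comp[OF linear_map_comp[OF Q' R] V2])
    fix x assume x: "x \<in> K"
    show "K.nrm (W1 x) = K.nrm x" using x by (simp add: W1_def Q_nrm R_nrm V1_nrm)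
    show "K.nrm (W2 x) = K.nrm x" using x by (simp add: W2_def Q'_nrm R_nrm V2_nrm)
    show "P (W1 x) = T1 (P x)" using x by (simp add: W1_def PQ PR)
    show "P (W2 x) = T2 (P x)" using x by (simp add: W2_def PQ' PR)
    show "W1 (W2 x) = q *\<^sub>C W2 (W1 x)"
      using x by (simp add: W1_def W2_def key Q'Q QQ' RR)
  qed
qed

end

section \<open>The concrete model on square-summable families\<close>

text \<open>
  The slot \<open>None\<close> carries the original space, and \<open>Some (l, b, j)\<close> is the \<open>j\<close>-th coordinate on
  level \<open>l\<close>; the flag \<open>b\<close> separates the ranges of the two defect maps.
\<close>

type_synonym slot = "(nat \<times> bool \<times> nat) option"

context hilbert
begin

text \<open>Shifted and defect families live on the image of an injection; their summability is
  checked on its source.\<close>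

lemma l2_supportI:
  assumes g: "inj_on g A" and S: "\<And>i. x i \<in> S" and supp: "\<And>i. i \<notin> g ` A \<Longrightarrow> x i = 0"
    and s: "(\<lambda>a. (nrm (x (g a)))\<^sup>2) summable_on A"
  shows "x \<in> l2"
proof (rule l2I[OF S])
  have "(\<lambda>i. (nrm (x i))\<^sup>2) summable_on (g ` A)"
    unfolding summable_on_reindex[OF g] using s by (simp add: comp_def)
  then show "(\<lambda>i. (nrm (x i))\<^sup>2) summable_on UNIV"
    by (rule summable_on_cong_neutral[THEN iffD1, rotated -1]) (auto simp: supp)
qed

lemma l2_ip_support:
  assumes g: "inj_on g A" and supp: "\<And>i. i \<notin> g ` A \<Longrightarrow> ip (x i) (y i) = 0"
  shows "l2_ip x y = (\<Sum>\<^sub>\<infinity>a\<in>A. ip (x (g a)) (y (g a)))"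
proof -
  have "l2_ip x y = (\<Sum>\<^sub>\<infinity>i\<in>g ` A. ip (x i) (y i))"
    unfolding l2_ip_def by (rule infsum_cong_neutral) (auto simp: supp)
  then show ?thesis by (simp add: infsum_reindex[OF g] comp_def)
qed

definition base_emb :: "'v \<Rightarrow> slot \<Rightarrow> 'v"
  where "base_emb h i = (case i of None \<Rightarrow> h | Some _ \<Rightarrow> 0)"

text \<open>Level 0 stays empty: the \<open>None\<close> coordinate is dropped rather than pushed
  there, since in the dilation the defect maps fill level 0.\<close>

definition fwd :: "(slot \<Rightarrow> 'v) \<Rightarrow> slot \<Rightarrow> 'v"
  where "fwd x i = (case i of Some (Suc l, b, j) \<Rightarrow> x (Some (l, b, j)) | _ \<Rightarrow> 0)"

definition bwd :: "(slot \<Rightarrow> 'v) \<Rightarrow> slot \<Rightarrow> 'v"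
  where "bwd x i = (case i of None \<Rightarrow> 0 | Some (l, b, j) \<Rightarrow> x (Some (Suc l, b, j)))"

definition defect :: "bool \<Rightarrow> (nat \<Rightarrow> 'v \<Rightarrow> 'v) \<Rightarrow> 'v \<Rightarrow> slot \<Rightarrow> 'v"
  where "defect b B h i = (case i of Some (0, b', j) \<Rightarrow> if b' = b then B j h else 0 | _ \<Rightarrow> 0)"

definition twist :: "complex \<Rightarrow> (slot \<Rightarrow> 'v) \<Rightarrow> slot \<Rightarrow> 'v"
  where "twist r x i = (case i of None \<Rightarrow> x i | Some (l, b, j) \<Rightarrow> r ^ (l div 2) *\<^sub>C x i)"

lemmas slot_defs = base_emb_def fwd_def bwd_def defect_def twist_def

text \<open>\<open>up\<close> fixes \<open>None\<close>, which makes it injective on all slots; it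
  describes the shift only away from \<open>None\<close>, hence the sets \<open>- {None}\<close>
  below.\<close>

definition up :: "slot \<Rightarrow> slot"
  where "up = map_option (\<lambda>(l, b, j). (Suc l, b, j))"

lemma up_inj: "inj_on up A"
  unfolding up_def by (rule inj_on_subset[OF option.inj_map]) (auto simp: inj_def)

lemma fwd_up: "i \<noteq> None \<Longrightarrow> fwd x (up i) = x i"
  by (auto simp: fwd_def up_def)

lemma fwd_zero:
  assumes "i \<notin> up ` (- {None})"
  shows "fwd x i = 0"
proof (cases i)
  case (Some t)
  obtain l b j where t: "t = (l, b, j)" by (cases t)
  show ?thesis
  proof (cases l)
    case (Suc k)
    then have "i = up (Some (k, b, j))" using Some t by (simp add: up_def)
    then show ?thesis using assms by blast
  qed (simp add: fwd_def Some t)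
qed (simp add: fwd_def)

lemma bwd_up: "i \<noteq> None \<Longrightarrow> bwd x i = x (up i)"
  by (auto simp: bwd_def up_def)

lemma base_emb_mem: "h \<in> S \<Longrightarrow> base_emb h \<in> l2"
  by (rule l2_supportI[of id "{None}"]) (auto simp: base_emb_def split: option.splits)

lemma base_emb_linear: "linear_map S l2 base_emb"
  by (rule linear_mapI)
    (auto simp: base_emb_mem fun_eq_iff base_emb_def split: option.splits)

lemma base_emb_adj: "x \<in> l2 \<Longrightarrow> h \<in> S \<Longrightarrow> l2_ip (base_emb h) x = ip h (x None)"
  by (subst l2_ip_support[of id "{None}"])
    (auto simp: base_emb_def l2_coord split: option.splits)

lemma fwd_mem:
  assumes x: "x \<in> l2"
  shows "fwd x \<in> l2"
proof (rule l2_supportI[OF up_inj])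
  show "fwd x i \<in> S" for i
    using l2_coord[OF x] by (auto simp: fwd_def split: option.splits nat.splits)
  have "(\<lambda>i. (nrm (x i))\<^sup>2) summable_on - {None}"
    using l2_summable[OF x] by (rule summable_on_subset_banach) simp
  then show "(\<lambda>a. (nrm (fwd x (up a)))\<^sup>2) summable_on - {None}"
    by (rule summable_on_cong[THEN iffD1, rotated]) (simp add: fwd_up)
qed (rule fwd_zero)

lemma bwd_mem:
  assumes x: "x \<in> l2"
  shows "bwd x \<in> l2"
proof (rule l2I)
  show "bwd x i \<in> S" for i
    using l2_coord[OF x] by (auto simp: bwd_def split: option.splits)
  have "(\<lambda>i. (nrm (x i))\<^sup>2) summable_on up ` (- {None})"
    using l2_summable[OF x] by (rule summable_on_subset_banach) simp
  then have "(\<lambda>i. (nrm (x (up i)))\<^sup>2) summable_on - {None}"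
    unfolding summable_on_reindex[OF up_inj] by (simp add: comp_def)
  then show "(\<lambda>i. (nrm (bwd x i))\<^sup>2) summable_on UNIV"
    by (rule summable_on_cong_neutral[THEN iffD1, rotated -1]) (auto simp: bwd_up, simp add: bwd_def)
qed

lemma fwd_adj:
  assumes x: "x \<in> l2" and y: "y \<in> l2"
  shows "l2_ip (fwd x) y = l2_ip x (bwd y)"
proof -
  have "l2_ip (fwd x) y = (\<Sum>\<^sub>\<infinity>i\<in>- {None}. ip (fwd x (up i)) (y (up i)))"
    by (rule l2_ip_support[OF up_inj]) (simp add: fwd_zero l2_coord[OF y])
  also have "\<dots> = (\<Sum>\<^sub>\<infinity>i\<in>- {None}. ip (x i) (bwd y i))"
    by (rule infsum_cong) (simp add: fwd_up bwd_up)
  also have "\<dots> = l2_ip x (bwd y)"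
    by (subst l2_ip_support[of id "- {None}"]) (auto simp: bwd_def l2_coord[OF x] split: option.splits)
  finally show ?thesis .
qed

lemma defect_mem:
  assumes B: "\<And>j. linear_map S S (B j)"
    and sums: "(\<lambda>j. (nrm (B j h))\<^sup>2) sums s" and h: "h \<in> S"
  shows "defect b B h \<in> l2" "Re (l2_ip (defect b B h) (defect b B h)) = s"
proof -
  define g :: "nat \<Rightarrow> slot" where "g j = Some (0, b, j)" for j
  have g: "inj g" by (auto simp: g_def inj_def)
  have gB: "defect b B h (g j) = B j h" for j by (simp add: g_def defect_def)
  have Bh: "B j h \<in> S" for j using linear_map_mem[OF B h] .
  have supp: "defect b B h i = 0" if "i \<notin> range g" for i
    using that by (force simp: defect_def g_def split: option.splits nat.splits)
  have S: "defect b B h i \<in> S" for i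
    using Bh by (auto simp: defect_def split: option.splits nat.splits)
  have hs: "((\<lambda>j. (nrm (B j h))\<^sup>2) has_sum s) UNIV"
    using sums by (rule sums_nonneg_imp_has_sum) simp
  then show "defect b B h \<in> l2"
    using S supp by (intro l2_supportI[OF g]) (auto simp: gB summable_on_def)
  have "l2_ip (defect b B h) (defect b B h) = (\<Sum>\<^sub>\<infinity>j. of_real ((nrm (B j h))\<^sup>2))"
    using supp Bh by (subst l2_ip_support[OF g]) (auto simp: gB ip_self intro!: infsum_cong)
  also have "\<dots> = of_real s" by (intro infsumI has_sum_of_real hs)
  finally show "Re (l2_ip (defect b B h) (defect b B h)) = s" by simp
qed

lemma twist_mem:
  assumes r: "cmod r = 1" and x: "x \<in> l2"
  shows "twist r x \<in> l2" "l2_ip (twist r x) (twist r x) = l2_ip x x"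
proof -
  have S: "twist r x i \<in> S" for i
    using l2_coord[OF x] by (auto simp: twist_def split: option.splits)
  have n: "nrm (twist r x i) = nrm (x i)" for i
    using l2_coord[OF x] r by (auto simp: twist_def nrm_scale norm_power split: option.splits)
  show m: "twist r x \<in> l2" using l2_comparison[OF S x] n by simp
  show "l2_ip (twist r x) (twist r x) = l2_ip x x"
    by (simp add: l2_ip_self[OF m] l2_ip_self[OF x] n)
qed

theorem q_commuting_dilation:
  assumes T1: "linear_map S S T1" and T2: "linear_map S S T2"
    and c1: "\<And>x. x \<in> S \<Longrightarrow> nrm (T1 x) \<le> nrm x" and c2: "\<And>x. x \<in> S \<Longrightarrow> nrm (T2 x) \<le> nrm x"
    and q: "cmod q = 1" and T12: "\<And>x. x \<in> S \<Longrightarrow> T1 (T2 x) = q *\<^sub>C T2 (T1 x)"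
  obtains W1 W2 :: "(slot \<Rightarrow> 'v) \<Rightarrow> slot \<Rightarrow> 'v"
  where "linear_map l2 l2 W1" "linear_map l2 l2 W2"
    "\<And>x. x \<in> l2 \<Longrightarrow> hilbert.nrm l2_ip (W1 x) = hilbert.nrm l2_ip x"
    "\<And>x. x \<in> l2 \<Longrightarrow> hilbert.nrm l2_ip (W2 x) = hilbert.nrm l2_ip x"
    "\<And>x. x \<in> l2 \<Longrightarrow> W1 (W2 x) = q *\<^sub>C W2 (W1 x)"
    "\<And>x. x \<in> l2 \<Longrightarrow> W1 x None = T1 (x None)" "\<And>x. x \<in> l2 \<Longrightarrow> W2 x None = T2 (x None)"
proof -
  obtain B1 where B1: "\<And>j. linear_map S S (B1 j)"
    and B1s: "\<And>h. h \<in> S \<Longrightarrow> (\<lambda>j. (nrm (B1 j h))\<^sup>2) sums ((nrm h)\<^sup>2 - (nrm (T1 h))\<^sup>2)"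
    using defect_sequence[OF T1 c1] by blast
  obtain B2 where B2: "\<And>j. linear_map S S (B2 j)"
    and B2s: "\<And>h. h \<in> S \<Longrightarrow> (\<lambda>j. (nrm (B2 j h))\<^sup>2) sums ((nrm h)\<^sup>2 - (nrm (T2 h))\<^sup>2)"
    using defect_sequence[OF T2 c2] by blast
  interpret K: hilbert "l2 :: (slot \<Rightarrow> 'v) set" l2_ip by (rule hilbert_l2)
  have qq: "q * cnj q = 1" "cnj q * q = 1"
    using q complex_norm_square[of q] by (simp_all add: mult.commute)
  have qpow: "q ^ n * cnj q ^ n = 1" "cnj q ^ n * q ^ n = 1" for n
    by (simp_all add: power_mult_distrib[symmetric] qq)
  have q': "cmod (cnj q) = 1" using q by simp
  have D_lin: "linear_map S l2 (defect b B)"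
    if B: "\<And>j. linear_map S S (B j)" and s: "\<And>h. h \<in> S \<Longrightarrow> (\<lambda>j. (nrm (B j h))\<^sup>2) sums s h" for b B s
    by (rule linear_mapI)
      (auto simp: defect_mem(1)[OF B s] fun_eq_iff defect_def linear_map_add[OF B]
        linear_map_scale[OF B] split: option.splits nat.splits)
  \<comment> \<open>Evaluation at \<open>None\<close> is the adjoint of \<open>base_emb\<close>.
    Opposite flags put the two defects on disjoint slots, which gives orthogonality, and
    \<open>cnj q\<close> is the inverse of \<open>q\<close>, which inverts the twist.\<close>
  interpret dilation_data S ip l2 l2_ip T1 T2 q base_emb "defect False B1" "defect True B2"
    "\<lambda>x. x None" fwd bwd "twist q" "twist (cnj q)"
  proof (unfold_locales, goal_cases)
    case 5 show ?case by (rule base_emb_linear)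
  next
    case 6 show ?case by (rule D_lin[OF B1 B1s])
  next
    case 7 show ?case by (rule D_lin[OF B2 B2s])
  next
    case 8 show ?case by (rule linear_mapI) (auto simp: l2_coord)
  next
    case 9 show ?case
      by (rule linear_mapI)
        (auto simp: fwd_mem fun_eq_iff fwd_def split: option.splits nat.splits)
  next
    case 10 show ?case
      by (rule linear_mapI) (auto simp: bwd_mem fun_eq_iff bwd_def split: option.splits)
  next
    case 11 show ?case
      by (rule linear_mapI) (auto simp: twist_mem(1)[OF q] fun_eq_iff twist_def
          scaleC_right_distrib mult.commute split: option.splits)
  next
    case 12 show ?case
      by (rule linear_mapI) (auto simp: twist_mem(1)[OF q'] fun_eq_iff twist_def
          scaleC_right_distrib mult.commute split: option.splits)
  next
    case (22 h) then show ?case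
      using defect_mem(2)[OF B1 B1s] by (simp add: K.nrm_sq defect_mem(1)[OF B1 B1s])
  next
    case (23 h) then show ?case
      using defect_mem(2)[OF B2 B2s] by (simp add: K.nrm_sq defect_mem(1)[OF B2 B2s])
  next
    case (24 h h') 
    have "ip (defect False B1 h i) (defect True B2 h' i) = 0" for i
      using 24 linear_map_mem[OF B1 24(1)] linear_map_mem[OF B2 24(2)]
      by (auto simp: defect_def split: option.splits nat.splits)
    then show ?case by (simp add: l2_ip_def)
  next
    case (27 x) then show ?case by (simp add: K.nrm_def twist_mem[OF q])
  qed (auto simp: T1 T2 q T12 base_emb_adj fwd_adj fun_eq_iff slot_defs qpow
      split: option.splits nat.splits)
  show ?thesis using dilation that by blast
qed

end

section \<open>Passing between records and vector spaces\<close>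

text \<open>
  Antilinear functionals carry pointwise operations, so \<open>emb\<close> turns the operations of the
  record into those of the type class.
\<close>

definition (in complex_inner_space) emb :: "'a \<Rightarrow> 'a \<Rightarrow> complex"
  where "emb x = (\<lambda>y. if y \<in> carrier H then cinner H x y else 0)"

context hilbert_space
begin

lemma emb_inj: "inj_on emb (carrier H)"
proof (rule inj_onI)
  fix x y assume x: "x \<in> carrier H" and y: "y \<in> carrier H" and e: "emb x = emb y"
  have m: "x \<ominus> y \<in> carrier H" using x y by simp
  have "cinner H x (x \<ominus> y) = cinner H y (x \<ominus> y)"
    using fun_cong[OF e, of "x \<ominus> y"] m by (simp add: emb_def)
  moreover have "x = (x \<ominus> y) \<oplus> y"
    using x y by (simp add: M.minus_eq M.a_assoc M.l_neg)
  ultimately have "cinner H (x \<ominus> y) (x \<ominus> y) = 0"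
    using cinner_add_left[OF m y m] by simp
  then have "x \<ominus> y = \<zero>" using cinner_definite m by blast
  then show "x = y" using \<open>x = (x \<ominus> y) \<oplus> y\<close> y by simp
qed

lemma emb_add: "x \<in> carrier H \<Longrightarrow> y \<in> carrier H \<Longrightarrow> emb (x \<oplus> y) = emb x + emb y"
  by (auto simp: emb_def fun_eq_iff cinner_add_left)

lemma emb_smult: "x \<in> carrier H \<Longrightarrow> emb (a \<odot> x) = a *\<^sub>C emb x"
  by (auto simp: emb_def fun_eq_iff cinner_smult_left scaleC_complex_def)

lemma emb_zero: "emb \<zero> = 0"
  using emb_add[of \<zero> \<zero>] by simp

lemma emb_diff:
  assumes "x \<in> carrier H" "y \<in> carrier H"
  shows "emb (x \<ominus> y) = emb x - emb y"
proof -
  have "(x \<ominus> y) \<oplus> y = x" using assms by (simp add: M.minus_eq M.a_assoc M.l_neg)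
  then show ?thesis using emb_add[of "x \<ominus> y" y] assms by (simp add: algebra_simps)
qed

definition unemb where "unemb = inv_into (carrier H) emb"

lemma unemb_emb [simp]: "x \<in> carrier H \<Longrightarrow> unemb (emb x) = x"
  by (simp add: unemb_def emb_inj)

definition emb_ip where "emb_ip f g = cinner H (unemb f) (unemb g)"

lemma emb_ip_emb: "x \<in> carrier H \<Longrightarrow> y \<in> carrier H \<Longrightarrow> emb_ip (emb x) (emb y) = cinner H x y"
  by (simp add: emb_ip_def)

lemma hilbert_emb: "hilbert (emb ` carrier H) emb_ip"
proof
  show "0 \<in> emb ` carrier H" using emb_zero M.zero_closed by (metis imageI)
next
  fix \<sigma> :: "nat \<Rightarrow> 'a \<Rightarrow> complex"
  assume mem: "\<And>n. \<sigma> n \<in> emb ` carrier H"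
    and Cauchy: "\<And>e. 0 < e \<Longrightarrow> \<exists>M. \<forall>m\<ge>M. \<forall>n\<ge>M.
      sqrt (Re (emb_ip (\<sigma> m - \<sigma> n) (\<sigma> m - \<sigma> n))) < e"
  define \<tau> where "\<tau> n = unemb (\<sigma> n)" for n
  have \<tau>: "\<tau> n \<in> carrier H" "\<sigma> n = emb (\<tau> n)" for n using mem[of n] by (auto simp: \<tau>_def)
  have dist: "sqrt (Re (emb_ip (emb x - emb y) (emb x - emb y))) = hdist H x y"
    if "x \<in> carrier H" "y \<in> carrier H" for x y
    using that by (simp add: emb_diff[symmetric] emb_ip_emb hdist_def hnorm_def)
  have "MCauchy \<tau>"
    unfolding MCauchy_def using \<tau>(1) Cauchy by (auto simp: \<tau>(2) dist)
  then obtain l where "limitin mtopology \<tau> l sequentially"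
    using complete unfolding mcomplete_def by blast
  then have l: "l \<in> carrier H" and lim: "(\<lambda>n. hdist H (\<tau> n) l) \<longlonglongrightarrow> 0"
    by (auto simp: limitin_metric_dist_null)
  show "\<exists>l\<in>emb ` carrier H. (\<lambda>n. sqrt (Re (emb_ip (\<sigma> n - l) (\<sigma> n - l)))) \<longlonglongrightarrow> 0"
    using l lim by (intro bexI[of _ "emb l"]) (simp_all add: \<tau> dist)
next
  fix f g assume "f \<in> emb ` carrier H" "g \<in> emb ` carrier H"
  then show "emb_ip g f = cnj (emb_ip f g)"
    by (auto simp: emb_ip_emb intro: cinner_cnj)
next
  fix f assume "f \<in> emb ` carrier H"
  then show "0 \<le> Re (emb_ip f f)" by (auto simp: emb_ip_emb cinner_nonneg)
next
  fix f assume "f \<in> emb ` carrier H" "emb_ip f f = 0"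
  then show "f = 0" using cinner_definite by (auto simp: emb_ip_emb emb_zero[symmetric])
next
  fix a f assume "f \<in> emb ` carrier H"
  then obtain x where x: "x \<in> carrier H" "f = emb x" by blast
  show "a *\<^sub>C f \<in> emb ` carrier H"
    unfolding x(2) emb_smult[OF x(1), symmetric] using x by (intro imageI) simp
  fix g assume "g \<in> emb ` carrier H"
  then obtain y where y: "y \<in> carrier H" "g = emb y" by blast
  show "emb_ip (a *\<^sub>C f) g = a * emb_ip f g"
    unfolding x(2) y(2) emb_smult[OF x(1), symmetric]
    using x y by (simp add: emb_ip_emb cinner_smult_left)
next
  fix f g assume "f \<in> emb ` carrier H" "g \<in> emb ` carrier H"
  then obtain x y where x: "x \<in> carrier H" "f = emb x" and y: "y \<in> carrier H" "g = emb y" by blast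
  show "f + g \<in> emb ` carrier H"
    unfolding x(2) y(2) emb_add[OF x(1) y(1), symmetric] using x y by (intro imageI) simp
  fix h assume "h \<in> emb ` carrier H"
  then obtain z where z: "z \<in> carrier H" "h = emb z" by blast
  show "emb_ip (f + g) h = emb_ip f h + emb_ip g h"
    unfolding x(2) y(2) z(2) emb_add[OF x(1) y(1), symmetric]
    using x y z by (simp add: emb_ip_emb cinner_add_left)
qed

end

section \<open>From carrier sets back to records\<close>

context hilbert
begin

text \<open>The witness type is prescribed as \<open>'a big\<close>, whereas the dilation space
  consists of functions on \<open>slot\<close>; the structure is carried over along an
  injection.\<close>

definition transport :: "('v \<Rightarrow> 'b) \<Rightarrow> 'b inner_space"
  where "transport \<phi> = (let \<psi> = inv_into S \<phi> in
    \<lparr>carrier = \<phi> ` S, monoid.mult = undefined, one = undefined, zero = \<phi> 0,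
      add = (\<lambda>x y. \<phi> (\<psi> x + \<psi> y)), smult = (\<lambda>a x. \<phi> (a *\<^sub>C \<psi> x)),
      cinner = (\<lambda>x y. ip (\<psi> x) (\<psi> y))\<rparr>)"

context
  fixes \<phi> :: "'v \<Rightarrow> 'b"
  assumes inj: "inj_on \<phi> S"
begin

lemma transport_simps [simp]:
  "carrier (transport \<phi>) = \<phi> ` S"
  "\<zero>\<^bsub>transport \<phi>\<^esub> = \<phi> 0"
  "x \<in> S \<Longrightarrow> y \<in> S \<Longrightarrow> \<phi> x \<oplus>\<^bsub>transport \<phi>\<^esub> \<phi> y = \<phi> (x + y)"
  "x \<in> S \<Longrightarrow> a \<odot>\<^bsub>transport \<phi>\<^esub> \<phi> x = \<phi> (a *\<^sub>C x)"
  "x \<in> S \<Longrightarrow> y \<in> S \<Longrightarrow> cinner (transport \<phi>) (\<phi> x) (\<phi> y) = ip x y"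
  by (simp_all add: transport_def Let_def inv_into_f_f[OF inj])

lemma abelian_group_transport: "abelian_group (transport \<phi>)"
proof (rule abelian_groupI)
  fix x assume "x \<in> carrier (transport \<phi>)"
  then obtain a where a: "a \<in> S" "x = \<phi> a" by auto
  then show "\<exists>y\<in>carrier (transport \<phi>). y \<oplus>\<^bsub>transport \<phi>\<^esub> x = \<zero>\<^bsub>transport \<phi>\<^esub>"
    by (auto intro!: bexI[of _ "- a"])
qed (auto simp: algebra_simps)

lemma complex_inner_space_transport: "complex_inner_space (transport \<phi>)"
proof (intro complex_inner_space.intro complex_inner_space_axioms.intro)
  show "module complex_ring (transport \<phi>)"
  proof (rule moduleI)
    show "cring complex_ring" by (rule cring_from_type_algebra)
    show "abelian_group (transport \<phi>)" by (rule abelian_group_transport)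
  qed (auto simp: ring_of_type_algebra_def scaleC_left_distrib scaleC_right_distrib)
qed (auto simp: ip_add_left ip_scale_left ip_nonneg intro: ip_cnj dest: ip_definite)

lemma transport_diff:
  assumes "x \<in> S" "y \<in> S"
  shows "\<phi> x \<ominus>\<^bsub>transport \<phi>\<^esub> \<phi> y = \<phi> (x - y)"
proof -
  interpret abelian_group "transport \<phi>" by (rule abelian_group_transport)
  have "\<ominus>\<^bsub>transport \<phi>\<^esub> \<phi> y = \<phi> (- y)"
    using assms by (intro minus_equality) auto
  then show ?thesis using assms by (simp add: a_minus_def)
qed

lemma transport_hnorm: "x \<in> S \<Longrightarrow> hnorm (transport \<phi>) (\<phi> x) = nrm x"
  by (simp add: hnorm_def nrm_def)

lemma transport_hdist:
  "x \<in> S \<Longrightarrow> y \<in> S \<Longrightarrow> hdist (transport \<phi>) (\<phi> x) (\<phi> y) = nrm (x - y)"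
  by (simp add: hdist_def transport_diff transport_hnorm)

theorem hilbert_space_transport: "hilbert_space (transport \<phi>)"
proof -
  interpret C: complex_inner_space "transport \<phi>" by (rule complex_inner_space_transport)
  have "\<exists>l. limitin C.mtopology \<sigma> l sequentially" if \<sigma>: "C.MCauchy \<sigma>" for \<sigma>
  proof -
    define \<tau> where "\<tau> n = inv_into S \<phi> (\<sigma> n)" for n
    have m: "\<sigma> n \<in> \<phi> ` S" for n using \<sigma> unfolding C.MCauchy_def by auto
    have \<tau>: "\<tau> n \<in> S" "\<sigma> n = \<phi> (\<tau> n)" for n
      using m[of n] by (simp_all add: \<tau>_def inv_into_into f_inv_into_f)
    have "\<exists>M. \<forall>m\<ge>M. \<forall>n\<ge>M. nrm (\<tau> m - \<tau> n) < e" if "0 < e" for e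
    proof -
      obtain M where "\<And>m n. M \<le> m \<Longrightarrow> M \<le> n \<Longrightarrow> hdist (transport \<phi>) (\<sigma> m) (\<sigma> n) < e"
        using \<sigma> \<open>0 < e\<close> unfolding C.MCauchy_def by blast
      then show ?thesis by (auto simp: \<tau> transport_hdist)
    qed
    then obtain l where l: "l \<in> S" "(\<lambda>n. nrm (\<tau> n - l)) \<longlonglongrightarrow> 0"
      using Cauchy_convergent_nrm[of \<tau>] \<tau>(1) by blast
    then have "limitin C.mtopology \<sigma> (\<phi> l) sequentially"
      unfolding C.limitin_metric_dist_null by (simp add: \<tau> transport_hdist)
    then show ?thesis by blast
  qed
  then have "C.mcomplete" unfolding C.mcomplete_def by blast
  then show ?thesis
    by (intro hilbert_space.intro hilbert_space_axioms.intro) (rule complex_inner_space_transport)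
qed

lemma isometry_transport:
  assumes W: "linear_map S S W" and n: "\<And>x. x \<in> S \<Longrightarrow> nrm (W x) = nrm x"
  shows "isometry (transport \<phi>) (transport \<phi>) (\<lambda>y. \<phi> (W (inv_into S \<phi> y)))"
  using W n linear_map_mem[OF W]
  by (auto simp: isometry_def linear_op_def inv_into_f_f[OF inj] linear_map_add[OF W]
      linear_map_scale[OF W] transport_hnorm)

end

end

lemma (in complex_inner_space) contraction_hnorm_le:
  assumes T: "contraction H T" and x: "x \<in> carrier H"
  shows "hnorm H (T x) \<le> hnorm H x"
proof -
  have lin: "T \<in> carrier H \<rightarrow> carrier H" "\<And>a x. x \<in> carrier H \<Longrightarrow> T (a \<odot> x) = a \<odot> T x"
    using T by (auto simp: contraction_def bounded_op_def linear_op_def)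
  obtain B where B: "\<And>x. x \<in> carrier H \<Longrightarrow> hnorm H (T x) \<le> B * hnorm H x"
    using T by (auto simp: contraction_def bounded_op_def)
  \<comment> \<open>A supremum of reals bounds its members only if the set is bounded above, which
    \<open>bounded_op\<close> supplies.\<close>
  have bdd: "bdd_above ((\<lambda>x. hnorm H (T x)) ` {x \<in> carrier H. hnorm H x \<le> 1})"
  proof (rule bdd_aboveI2)
    fix x assume x: "x \<in> {x \<in> carrier H. hnorm H x \<le> 1}"
    then have "B * hnorm H x \<le> \<bar>B\<bar> * 1"
      using hnorm_nonneg[of x] by (intro mult_mono) auto
    then show "hnorm H (T x) \<le> \<bar>B\<bar>" using B[of x] x by simp
  qed
  have unit: "hnorm H (T x) \<le> 1" if "x \<in> carrier H" "hnorm H x \<le> 1" for x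
    using cSUP_upper[OF _ bdd, of x] that T by (simp add: contraction_def op_norm_def)
  show ?thesis
  \<comment> \<open>A vector of norm 0 cannot be normalized, so the bound \<open>B\<close> settles
    that case; any other is scaled to norm 1 to come under \<open>unit\<close>.\<close>
  proof (cases "hnorm H x = 0")
    case True
    then show ?thesis using B[OF x] by simp
  next
    case False
    define a where "a = complex_of_real (1 / hnorm H x)"
    have pos: "hnorm H x > 0" using False hnorm_nonneg[OF x] by simp
    have "hnorm H (T (a \<odot> x)) \<le> 1"
      using x pos by (intro unit) (auto simp: hnorm_smult a_def norm_divide)
    then have "(1 / hnorm H x) * hnorm H (T x) \<le> 1"
      using x pos lin by (simp add: hnorm_smult Pi_iff a_def norm_divide)
    then show ?thesis using pos by (simp add: field_simps)
  qed
qed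

text \<open>\<open>orth_proj\<close> is a definite description, so uniqueness has to be supplied
  along with existence.\<close>

lemma orth_proj_eqI:
  assumes "y \<in> M" "\<And>z. z \<in> M \<Longrightarrow> cinner K (x \<ominus>\<^bsub>K\<^esub> y) z = 0"
    and "\<And>y'. y' \<in> M \<Longrightarrow> (\<And>z. z \<in> M \<Longrightarrow> cinner K (x \<ominus>\<^bsub>K\<^esub> y') z = 0) \<Longrightarrow> y' = y"
  shows "orth_proj K M x = y"
  unfolding orth_proj_def using assms by (intro the_equality) blast+

theorem corollary2p2:
  fixes H :: "'a inner_space" and T1 T2 :: "'a \<Rightarrow> 'a" and q :: complex
  assumes "hilbert_space H"
    and "contraction H T1" and "contraction H T2"
    and "cmod q = 1"
    and "q_commute H q T1 T2"
  shows "\<exists>(K :: 'a big inner_space) (J :: 'a \<Rightarrow> 'a big) V1 V2.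
      hilbert_space K \<and> isometry H K J \<and>
      isometry K K V1 \<and> isometry K K V2 \<and>
      q_commute K q V1 V2 \<and>
      (\<forall>k1 k2 :: nat. \<forall>h\<in>carrier H.
        J ((T1 ^^ k1) ((T2 ^^ k2) h))
          = orth_proj K (J ` carrier H) ((V1 ^^ k1) ((V2 ^^ k2) (J h))))"
proof -
  interpret H: hilbert_space H by fact
  define S where "S = H.emb ` carrier H"
  interpret hilbert S H.emb_ip unfolding S_def by (rule H.hilbert_emb)
  have emb_mem [simp]: "H.emb h \<in> S" if "h \<in> carrier H" for h using that by (simp add: S_def)
  have nrm_emb: "nrm (H.emb h) = hnorm H h" if "h \<in> carrier H" for h
    using that by (simp add: nrm_def hnorm_def H.emb_ip_emb)
  have T_mem: "T h \<in> carrier H" if "contraction H T" "h \<in> carrier H" for T h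
    using that by (auto simp: contraction_def bounded_op_def linear_op_def)
  have T_add: "T (x \<oplus>\<^bsub>H\<^esub> y) = T x \<oplus>\<^bsub>H\<^esub> T y"
    if "contraction H T" "x \<in> carrier H" "y \<in> carrier H" for T x y
    using that by (auto simp: contraction_def bounded_op_def linear_op_def)
  have T_smult: "T (a \<odot>\<^bsub>H\<^esub> x) = a \<odot>\<^bsub>H\<^esub> T x" if "contraction H T" "x \<in> carrier H" for T a x
    using that by (auto simp: contraction_def bounded_op_def linear_op_def)
  define lift where "lift T f = H.emb (T (H.unemb f))" for T f
  have lift_emb [simp]: "lift T (H.emb h) = H.emb (T h)" if "h \<in> carrier H" for T h
    using that by (simp add: lift_def)
  have lift_linear: "linear_map S S (lift T)" if T: "contraction H T" for T
  proof (rule linear_mapI)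
    fix f g a assume "f \<in> S" "g \<in> S"
    then obtain x y where x: "x \<in> carrier H" "f = H.emb x" and y: "y \<in> carrier H" "g = H.emb y"
      unfolding S_def by blast
    show "lift T (f + g) = lift T f + lift T g"
      using x y T by (simp add: H.emb_add[symmetric] T_mem T_add)
  qed (use T in \<open>auto simp: S_def T_mem T_smult H.emb_smult[symmetric]\<close>)
  have lift_le: "nrm (lift T f) \<le> nrm f" if "contraction H T" "f \<in> S" for T f
    using that by (auto simp: S_def T_mem nrm_emb H.contraction_hnorm_le)
  have lift_comm: "lift T1 (lift T2 f) = q *\<^sub>C lift T2 (lift T1 f)" if "f \<in> S" for f
    using that assms by (auto simp: S_def T_mem H.emb_smult[symmetric] q_commute_def)
  obtain W1 W2 :: "(slot \<Rightarrow> 'a \<Rightarrow> complex) \<Rightarrow> slot \<Rightarrow> 'a \<Rightarrow> complex"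
    where W1: "linear_map l2 l2 W1" and W2: "linear_map l2 l2 W2"
      and W1_nrm: "\<And>x. x \<in> l2 \<Longrightarrow> hilbert.nrm l2_ip (W1 x) = hilbert.nrm l2_ip x"
      and W2_nrm: "\<And>x. x \<in> l2 \<Longrightarrow> hilbert.nrm l2_ip (W2 x) = hilbert.nrm l2_ip x"
      and W12: "\<And>x. x \<in> l2 \<Longrightarrow> W1 (W2 x) = q *\<^sub>C W2 (W1 x)"
      and W1_base: "\<And>x. x \<in> l2 \<Longrightarrow> W1 x None = lift T1 (x None)"
      and W2_base: "\<And>x. x \<in> l2 \<Longrightarrow> W2 x None = lift T2 (x None)"
  proof (rule q_commuting_dilation[of "lift T1" "lift T2" q])
    fix W1 W2 :: "(slot \<Rightarrow> 'a \<Rightarrow> complex) \<Rightarrow> slot \<Rightarrow> 'a \<Rightarrow> complex"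
    assume "linear_map l2 l2 W1" "linear_map l2 l2 W2"
      "\<And>x. x \<in> l2 \<Longrightarrow> hilbert.nrm l2_ip (W1 x) = hilbert.nrm l2_ip x"
      "\<And>x. x \<in> l2 \<Longrightarrow> hilbert.nrm l2_ip (W2 x) = hilbert.nrm l2_ip x"
      "\<And>x. x \<in> l2 \<Longrightarrow> W1 (W2 x) = q *\<^sub>C W2 (W1 x)"
      "\<And>x. x \<in> l2 \<Longrightarrow> W1 x None = lift T1 (x None)"
      "\<And>x. x \<in> l2 \<Longrightarrow> W2 x None = lift T2 (x None)"
    then show thesis by (rule that)
  qed (use assms lift_linear lift_le lift_comm in auto)
  interpret K: hilbert "l2 :: (slot \<Rightarrow> 'a \<Rightarrow> complex) set" l2_ip by (rule hilbert_l2)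
  \<comment> \<open>Slots are countable, so natural numbers index them through
    \<open>from_nat\<close>; every slot is reached, which makes \<phi> injective.\<close>
  define \<phi> :: "(slot \<Rightarrow> 'a \<Rightarrow> complex) \<Rightarrow> 'a big" where "\<phi> x = (\<lambda>(n, y). x (from_nat n) y)" for x
  have inj: "inj_on \<phi> A" for A
  proof (rule inj_onI)
    fix x y assume "\<phi> x = \<phi> y"
    then have "\<phi> x (to_nat i, a) = \<phi> y (to_nat i, a)" for i :: slot and a by simp
    then show "x = y" by (simp add: \<phi>_def fun_eq_iff)
  qed
  note [simp] = K.transport_simps[OF inj] inv_into_f_f[OF inj]
  define R where "R = K.transport \<phi>"
  define J where "J h = \<phi> (base_emb (H.emb h))" for h
  define V where "V W y = \<phi> (W (inv_into l2 \<phi> y))"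
    for W :: "(slot \<Rightarrow> 'a \<Rightarrow> complex) \<Rightarrow> slot \<Rightarrow> 'a \<Rightarrow> complex" and y
  have V_phi: "V W (\<phi> x) = \<phi> (W x)" if "x \<in> l2" for W x using that by (simp add: V_def)
  have "isometry H R J"
    unfolding isometry_def linear_op_def
  proof (intro conjI ballI allI)
    fix x y a assume x: "x \<in> carrier H"
    show "J (a \<odot>\<^bsub>H\<^esub> x) = a \<odot>\<^bsub>R\<^esub> J x"
      using x by (simp add: R_def J_def base_emb_mem H.emb_smult linear_map_scale[OF base_emb_linear])
    show "hnorm R (J x) = hnorm H x"
      using x by (simp add: R_def J_def hnorm_def base_emb_mem base_emb_adj)
        (simp add: base_emb_def H.emb_ip_emb)
    assume y: "y \<in> carrier H"
    show "J (x \<oplus>\<^bsub>H\<^esub> y) = J x \<oplus>\<^bsub>R\<^esub> J y"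
      using x y by (simp add: R_def J_def base_emb_mem H.emb_add linear_map_add[OF base_emb_linear])
  qed (auto simp: R_def J_def base_emb_mem)
  moreover have "isometry R R (V W1)" "isometry R R (V W2)"
    unfolding R_def V_def by (rule K.isometry_transport[OF inj]; fact)+
  moreover have "q_commute R q (V W1) (V W2)"
    using linear_map_mem[OF W1] linear_map_mem[OF W2]
    by (auto simp: q_commute_def R_def V_phi W12)
  moreover have "J ((T1 ^^ k1) ((T2 ^^ k2) h))
      = orth_proj R (J ` carrier H) ((V W1 ^^ k1) ((V W2 ^^ k2) (J h)))"
    if h: "h \<in> carrier H" for k1 k2 h
  proof -
    \<comment> \<open>The relation \<open>WT\<close> holds at every \<open>x\<close>, not just on
      the base space, so it iterates; this is where invariance of the orthogonal complement of
      \<open>H\<close> enters.\<close>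
    have pow: "(V W ^^ k) (\<phi> x) = \<phi> ((W ^^ k) x) \<and> (W ^^ k) x \<in> l2 \<and>
        (W ^^ k) x None = H.emb ((T ^^ k) g) \<and> (T ^^ k) g \<in> carrier H"
      if W: "linear_map l2 l2 W" and WT: "\<And>x. x \<in> l2 \<Longrightarrow> W x None = lift T (x None)"
        and T: "contraction H T" and x: "x \<in> l2" "x None = H.emb g" "g \<in> carrier H" for W T k x g
      using x linear_map_mem[OF W] by (induction k) (simp_all add: V_phi WT T T_mem)
    define w where "w = (W1 ^^ k1) ((W2 ^^ k2) (base_emb (H.emb h)))"
    define t where "t = (T1 ^^ k1) ((T2 ^^ k2) h)"
    have b: "base_emb (H.emb h) None = H.emb h" by (simp add: base_emb_def)
    note p2 = pow[OF W2 W2_base assms(3) base_emb_mem[OF emb_mem[OF h]] b h, of k2]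
    have w: "w \<in> l2" "w None = H.emb t" and t: "t \<in> carrier H"
      and Vw: "(V W1 ^^ k1) ((V W2 ^^ k2) (J h)) = \<phi> w"
      using p2 pow[OF W1 W1_base assms(2), of "(W2 ^^ k2) (base_emb (H.emb h))" _ k1]
      unfolding w_def t_def J_def by auto
    \<comment> \<open>Pairing with \<open>J g'\<close> sees only the \<open>None\<close> coordinate,
      where \<open>w\<close> has the value \<open>H.emb t\<close>.\<close>
    have ip: "cinner R (\<phi> w \<ominus>\<^bsub>R\<^esub> J g) (J g') = cinner H (t \<ominus>\<^bsub>H\<^esub> g) g'"
      if g: "g \<in> carrier H" "g' \<in> carrier H" for g g'
    proof -
      let ?x = "w - base_emb (H.emb g)"
      have x: "?x \<in> l2" using g w by (simp add: base_emb_mem)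
      have "cinner R (\<phi> w \<ominus>\<^bsub>R\<^esub> J g) (J g') = l2_ip ?x (base_emb (H.emb g'))"
        using g w x by (simp add: R_def J_def K.transport_diff[OF inj] base_emb_mem)
      also have "\<dots> = cnj (l2_ip (base_emb (H.emb g')) ?x)"
        using x g by (intro K.ip_cnj base_emb_mem) auto
      also have "\<dots> = cnj (H.emb_ip (H.emb g') (H.emb (t \<ominus>\<^bsub>H\<^esub> g)))"
        using x g w t by (simp add: base_emb_adj H.emb_diff) (simp add: base_emb_def)
      also have "\<dots> = cinner H (t \<ominus>\<^bsub>H\<^esub> g) g'"
        using g t H.cinner_cnj[of g' "t \<ominus>\<^bsub>H\<^esub> g"] by (simp add: H.emb_ip_emb)
      finally show ?thesis .
    qed
    have "orth_proj R (J ` carrier H) (\<phi> w) = J t"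
    proof (rule orth_proj_eqI)
      show "cinner R (\<phi> w \<ominus>\<^bsub>R\<^esub> J t) z = 0" if z: "z \<in> J ` carrier H" for z
      proof -
        have "t \<ominus>\<^bsub>H\<^esub> t = \<zero>\<^bsub>H\<^esub>" using t by (simp add: H.M.minus_eq H.M.r_neg)
        moreover have "cinner H \<zero>\<^bsub>H\<^esub> g = 0" if "g \<in> carrier H" for g
          using H.cinner_add_left[of "\<zero>\<^bsub>H\<^esub>" "\<zero>\<^bsub>H\<^esub>" g] that by simp
        ultimately show ?thesis using z t ip by auto
      qed
      fix y assume "y \<in> J ` carrier H"
      then obtain g where g: "g \<in> carrier H" "y = J g" by blast
      assume "\<And>z. z \<in> J ` carrier H \<Longrightarrow> cinner R (\<phi> w \<ominus>\<^bsub>R\<^esub> y) z = 0"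
      \<comment> \<open>Uniqueness: the candidate \<open>J g\<close> is tested against the image of
        the difference itself.\<close>
      then have "cinner H (t \<ominus>\<^bsub>H\<^esub> g) (t \<ominus>\<^bsub>H\<^esub> g) = 0" using ip[of g "t \<ominus>\<^bsub>H\<^esub> g"] g t by simp
      then have "t \<ominus>\<^bsub>H\<^esub> g = \<zero>\<^bsub>H\<^esub>" using H.cinner_definite g t by simp
      then have "H.emb t = H.emb g" using H.emb_diff[of t g] g t H.emb_zero by simp
      then show "y = J t" by (simp add: g J_def)
    qed (use t in simp)
    then show ?thesis by (simp add: Vw t_def)
  qed
  moreover have "hilbert_space R" unfolding R_def by (rule K.hilbert_space_transport[OF inj])
  ultimately show ?thesis by blast
qed

end
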